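(* Let $m\geq 1$ and let $S_n=(E_{n-m},K_m)$ be a split graph on $n$ vertices in which every vertex of the independent set $E_{n-m}$ has degree at most $2$. Then $S_n$ is word-representable if and only if $S_n$ contains neither the graph $T_2$ nor any of the graphs $A_\ell$, $\ell\geq 4$, as an induced subgraph.
   Context: All graphs are finite and simple. Two distinct letters $x,y$ alternate in a word $w$ if deleting all letters of $w$ other than the copies of $x$ and $y$ leaves a word $xyxy\cdots$ or $yxyx\cdots$ (of even or odd length). A graph $G=(V,E)$ is word-representable if there is a word $w$ over the alphabet $V$, containing each letter of $V$, such that for all distinct $x,y\in V$, $x$ and $y$ alternate in $w$ if and only if $xy\in E$. Split graph convention: $S_n=(E_{n-m},K_m)$ denotes a graph on $n$ vertices whose vertex set is partitioned into a clique $K_m$ on $m$ vertices and an independent set $E_{n-m}$ on $n-m$ vertices, where the clique $K_m$ is maximal, i.e. every vertex of $E_{n-m}$ has degree at most $m-1$. $T_2$: the graph on 7 vertices consisting of a clique on $\{1,2,3,4\}$ and three further pairwise non-adjacent vertices with neighbourhoods $\{1,2\}$, $\{2,3\}$ and $\{2,4\}$, respectively. $K^{\triangle}_\ell$ ($\ell\geq 3$): the graph obtained from the complete graph on $\{1,\ldots,\ell\}$ by adding, for each $i\in\{1,\ldots,\ell-1\}$, a vertex $i'$ adjacent exactly to $i$ and $i+1$, and a vertex $\ell'$ adjacent exactly to $1$ and $\ell$. $A_\ell$ ($\ell\geq 4$): the graph obtained from $K^{\triangle}_{\ell-1}$ by adding one new vertex adjacent exactly to the vertices $1,2,\ldots,\ell-1$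 of its clique. *)

theory Defs
  imports "Graph_Theory.Graph_Theory"
begin

text \<open>
  A finite simple graph is a \<^locale>\<open>pair_graph\<close>: a finite, loop-free digraph with a symmetric
  arc relation and without parallel arcs. An undirected edge \<open>xy\<close> is the pair of arcs
  \<open>(x, y)\<close>, \<open>(y, x)\<close>; hence the degree of a vertex is its \<^const>\<open>out_degree\<close>.
\<close>

subsection \<open>Word-representability\<close>

definition alt_word :: "'a \<Rightarrow> 'a \<Rightarrow> nat \<Rightarrow> 'a list" where
  "alt_word x y k = map (\<lambda>i. if even i then x else y) [0..<k]"

definition alternate :: "'a \<Rightarrow> 'a \<Rightarrow> 'a list \<Rightarrow> bool" where
  "alternate x y w \<longleftrightarrow>
    (\<exists>k. filter (\<lambda>z. z = x \<or> z = y) w = alt_word x y k \<or>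
         filter (\<lambda>z. z = x \<or> z = y) w = alt_word y x k)"

definition word_representable :: "'a pair_pre_digraph \<Rightarrow> bool" where
  "word_representable G \<longleftrightarrow>
    (\<exists>w. set w = pverts G \<and>
      (\<forall>x \<in> pverts G. \<forall>y \<in> pverts G. x \<noteq> y \<longrightarrow> (alternate x y w \<longleftrightarrow> (x, y) \<in> parcs G)))"

subsection \<open>Split graphs\<close>

text \<open>
  The last conjunct is the maximality of the clique \<open>K\<close>. The subtraction is the intended one
  only for \<open>m \<ge> 1\<close>.
\<close>

definition split_graph ::
    "'a pair_pre_digraph \<Rightarrow> nat \<Rightarrow> nat \<Rightarrow> 'a set \<Rightarrow> 'a set \<Rightarrow> bool" where
  "split_graph G n m I K \<longleftrightarrow>
    pair_graph G \<and> card (pverts G) = n \<and>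
    pverts G = I \<union> K \<and> I \<inter> K = {} \<and> card K = m \<and>
    (\<forall>u \<in> K. \<forall>v \<in> K. u \<noteq> v \<longrightarrow> (u, v) \<in> parcs G) \<and>
    (\<forall>u \<in> I. \<forall>v \<in> I. (u, v) \<notin> parcs G) \<and>
    (\<forall>v \<in> I. out_degree (with_proj G) v \<le> m - 1)"

subsection \<open>Induced subgraphs\<close>

definition contains_induced :: "'a pair_pre_digraph \<Rightarrow> 'b pair_pre_digraph \<Rightarrow> bool" where
  "contains_induced G H \<longleftrightarrow>
    (\<exists>S \<subseteq> pverts G. digraph_iso (with_proj H) (induce_subgraph (with_proj G) S))"

subsection \<open>The forbidden graphs\<close>

text \<open>
  \<open>Clq i\<close> is the clique vertex \<open>i\<close>, \<open>Tip i\<close> is the vertex \<open>i'\<close>, and \<open>Apex\<close> is the vertex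
  added to the \<open>K\<close>-triangle graph in the construction of the graphs \<open>A\<close>.
\<close>

datatype vtx = Clq nat | Tip nat | Apex

definition undirected :: "'a set \<Rightarrow> 'a rel \<Rightarrow> 'a pair_pre_digraph" where
  "undirected V E = \<lparr> pverts = V, parcs = E \<union> E\<inverse> \<rparr>"

definition clique_arcs :: "nat \<Rightarrow> vtx rel" where
  "clique_arcs l = {(Clq i, Clq j) | i j. i \<in> {1..l} \<and> j \<in> {1..l} \<and> i \<noteq> j}"

definition T2 :: "vtx pair_pre_digraph" where
  "T2 = undirected (Clq ` {1..4} \<union> Tip ` {1..3})
    (clique_arcs 4 \<union>
     {(Tip 1, Clq 1), (Tip 1, Clq 2),
      (Tip 2, Clq 2), (Tip 2, Clq 3),
      (Tip 3, Clq 2), (Tip 3, Clq 4)})"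

definition K_triangle :: "nat \<Rightarrow> vtx pair_pre_digraph" where
  "K_triangle l = undirected (Clq ` {1..l} \<union> Tip ` {1..l})
    (clique_arcs l \<union>
     {(Tip i, Clq i) | i. i \<in> {1..l-1}} \<union> {(Tip i, Clq (i + 1)) | i. i \<in> {1..l-1}} \<union>
     {(Tip l, Clq 1), (Tip l, Clq l)})"

definition A_graph :: "nat \<Rightarrow> vtx pair_pre_digraph" where
  "A_graph l = undirected (insert Apex (pverts (K_triangle (l - 1))))
    (parcs (K_triangle (l - 1)) \<union> {(Apex, Clq i) | i. i \<in> {1..l-1}})"

lemma pair_graph_undirected:
  assumes "finite V" "E \<subseteq> V \<times> V" "\<And>x. (x, x) \<notin> E"
  shows "pair_graph (undirected V E)"
proof -
  have "finite E" using assms finite_subset by blast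
  then show ?thesis
    using assms by unfold_locales (auto simp: undirected_def symmetric_def intro!: symI)
qed

lemma pair_graph_T2: "pair_graph T2"
  unfolding T2_def by (rule pair_graph_undirected) (auto simp: clique_arcs_def)

lemma pair_graph_K_triangle: "l \<ge> 3 \<Longrightarrow> pair_graph (K_triangle l)"
  unfolding K_triangle_def by (rule pair_graph_undirected) (auto simp: clique_arcs_def)

lemma pair_graph_A_graph: "l \<ge> 4 \<Longrightarrow> pair_graph (A_graph l)"
  unfolding A_graph_def
  by (rule pair_graph_undirected) (auto simp: K_triangle_def undirected_def clique_arcs_def)

end

theory Submission
  imports Defs
begin

text \<open>
  Pairwise alternating letters repeat in a fixed cyclic order. If a letter \<open>x\<close> alternates with two
  of them, \<open>a\<close> and \<open>b\<close>, it stays in one of the two arcs between \<open>a\<close> and \<open>b\<close> and therefore alternates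
  with all letters of the other arc. So if \<open>a\<close> and \<open>b\<close> are the only clique neighbours of \<open>x\<close>, they
  are cyclically adjacent. This is impossible for the three edges at a common vertex in \<open>T\<^sub>2\<close> and for
  the non-spanning cycle in \<open>A\<^sub>l\<close>.

  Conversely, call two clique vertices joined if they are the neighbourhood of an independent vertex.
  Without \<open>T\<^sub>2\<close> and \<open>A\<^sub>l\<close> this graph has maximum degree two and all its cycles are spanning, so the
  clique has a cyclic order \<open>c\<^sub>1 \<dots> c\<^sub>m\<close> in which joined vertices are consecutive. A representing word is
  obtained from \<open>c\<^sub>1 \<dots> c\<^sub>m c\<^sub>1 \<dots> c\<^sub>m\<close> by inserting each independent vertex immediately before and
  after its neighbourhood, or, if this is \<open>{c\<^sub>1, c\<^sub>m}\<close>, after the first \<open>c\<^sub>1\<close> and before the last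
  \<open>c\<^sub>m\<close>. Most of them are inserted once more at the end, in reverse order, to
  destroy alternation between independent vertices.
\<close>

subsection \<open>Alternation in terms of prefixes\<close>

text \<open>Alternation beginning with \<open>x\<close>, phrased by counts in all prefixes, so that
  statements about several letters become linear inequalities. If neither letter occurs, each of
  them leads the other.\<close>

definition leads :: "'a \<Rightarrow> 'a \<Rightarrow> 'a list \<Rightarrow> bool" where
  "leads x y w \<longleftrightarrow>
    (\<forall>n. count_list (take n w) y \<le> count_list (take n w) x \<and>
         count_list (take n w) x \<le> Suc (count_list (take n w) y))"

lemma leads_snoc:
  "leads x y (w @ [z]) \<longleftrightarrow>
    leads x y w \<and> count_list (w @ [z]) y \<le> count_list (w @ [z]) x \<and>
    count_list (w @ [z]) x \<le> Suc (count_list (w @ [z]) y)"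
  (is "?l \<longleftrightarrow> ?r")
proof
  assume l: ?l
  \<comment> \<open>Cutting at \<open>min n (length w)\<close> keeps the prefix inside
    \<open>w\<close>.\<close>
  have "count_list (take n w) y \<le> count_list (take n w) x \<and>
      count_list (take n w) x \<le> Suc (count_list (take n w) y)" for n
    using l[unfolded leads_def, rule_format, of "min n (length w)"] by (simp add: min_def split: if_splits)
  moreover note l[unfolded leads_def, rule_format, of "Suc (length w)"]
  ultimately show ?r unfolding leads_def by simp
next
  assume r: ?r
  show ?l unfolding leads_def
  proof
    fix n
    show "count_list (take n (w @ [z])) y \<le> count_list (take n (w @ [z])) x \<and>
      count_list (take n (w @ [z])) x \<le> Suc (count_list (take n (w @ [z])) y)"
    proof (cases "n \<le> length w")
      case True
      then show ?thesis using r[unfolded leads_def] by simp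
    next
      case False
      then show ?thesis using r by simp
    qed
  qed
qed

lemma alt_word_0: "alt_word x y 0 = []"
  by (simp add: alt_word_def)

lemma alt_word_Suc: "alt_word x y (Suc k) = alt_word x y k @ [if even k then x else y]"
  by (simp add: alt_word_def)

lemma count_alt_word:
  assumes "x \<noteq> y"
  shows "count_list (alt_word x y k) x = Suc k div 2 \<and> count_list (alt_word x y k) y = k div 2"
  using assms by (induction k) (auto simp: alt_word_0 alt_word_Suc)

lemma snoc_eq_alt_word:
  "u @ [z] = alt_word x y k \<longleftrightarrow> (\<exists>j. k = Suc j \<and> u = alt_word x y j \<and> z = (if even j then x else y))"
  by (cases k) (auto simp: alt_word_0 alt_word_Suc)

lemma count_list_filter: "P x \<Longrightarrow> count_list (filter P w) x = count_list w x"
  by (induction w) auto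

text \<open>In an alternating word the parity of the length tells whether the counts are equal or
  \<open>x\<close> is ahead, so the two bounds leave only one letter with which the pattern can
  continue.\<close>

lemma leads_iff_alt_word:
  assumes "x \<noteq> y"
  shows "leads x y w \<longleftrightarrow> (\<exists>k. filter (\<lambda>z. z = x \<or> z = y) w = alt_word x y k)"
proof (induction w rule: rev_induct)
  case Nil
  have "[] = alt_word x y 0" by (simp add: alt_word_0)
  then show ?case unfolding leads_def by auto
next
  case (snoc z w)
  have count: "count_list w x = Suc k div 2 \<and> count_list w y = k div 2"
    if "filter (\<lambda>z. z = x \<or> z = y) w = alt_word x y k" for k
    using count_alt_word[OF assms, of k] count_list_filter[of "\<lambda>z. z = x \<or> z = y" x w]
      count_list_filter[of "\<lambda>z. z = x \<or> z = y" y w] that by simp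
  show ?case
  proof (cases "z = x \<or> z = y")
    case False
    have "leads x y w \<Longrightarrow> count_list w y \<le> count_list w x \<and> count_list w x \<le> Suc (count_list w y)"
      unfolding leads_def by (metis order_refl take_all)
    with False show ?thesis using snoc.IH by (auto simp: leads_snoc)
  next
    case True
    show ?thesis
    proof
      assume "leads x y (w @ [z])"
      then have l: "leads x y w" and c: "count_list (w @ [z]) y \<le> count_list (w @ [z]) x"
          "count_list (w @ [z]) x \<le> Suc (count_list (w @ [z]) y)"
        by (auto simp: leads_snoc)
      obtain k where k: "filter (\<lambda>z. z = x \<or> z = y) w = alt_word x y k"
        using l snoc.IH by blast
      have "z = (if even k then x else y)"
        using True c count[OF k] assms by (cases "even k") auto
      then show "\<exists>k. filter (\<lambda>z. z = x \<or> z = y) (w @ [z]) = alt_word x y k"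
        using True k by (intro exI[of _ "Suc k"]) (simp add: alt_word_Suc)
    next
      assume "\<exists>k. filter (\<lambda>z. z = x \<or> z = y) (w @ [z]) = alt_word x y k"
      then obtain k where k: "filter (\<lambda>z. z = x \<or> z = y) w = alt_word x y k"
          and z: "z = (if even k then x else y)"
        using True by (auto simp: snoc_eq_alt_word)
      then show "leads x y (w @ [z])"
        using snoc.IH count[OF k] assms by (cases "even k") (auto simp: leads_snoc)
    qed
  qed
qed

lemma alternate_iff_leads:
  assumes "x \<noteq> y"
  shows "alternate x y w \<longleftrightarrow> leads x y w \<or> leads y x w"
proof -
  have "(\<lambda>z. z = x \<or> z = y) = (\<lambda>z. z = y \<or> z = x)" by auto
  then show ?thesis
    using leads_iff_alt_word[OF assms, of w] leads_iff_alt_word[OF assms[symmetric], of w]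
    unfolding alternate_def by metis
qed

lemma alternate_commute: "alternate x y w \<longleftrightarrow> alternate y x w"
proof (cases "x = y")
  case False
  then show ?thesis by (metis alternate_iff_leads)
qed simp

text \<open>In every prefix the count of \<open>c\<close> is squeezed between those of
  \<open>b\<close> and \<open>a\<close>, which differ by at most one. All comparisons with
  \<open>x\<close> follow from such bounds.\<close>

lemma leads_separated:
  assumes ab: "leads a b w" and ac: "leads a c w" and cb: "leads c b w"
    and d: "leads d a w \<and> leads d b w \<or> leads a d w \<and> leads b d w"
    and xa: "leads x a w \<or> leads a x w" and xb: "leads x b w \<or> leads b x w"
  shows "leads c x w \<or> leads x c w \<or> leads d x w \<or> leads x d w"
proof -
  have le: "count_list (take n w) b' \<le> count_list (take n w) a' \<and>
      count_list (take n w) a' \<le> Suc (count_list (take n w) b')" if "leads a' b' w" for a' b' n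
    using that unfolding leads_def by blast
  \<comment> \<open>In cases 1 and 2 the letter \<open>x\<close> shares the arc of \<open>c\<close>
    and alternates with \<open>d\<close>; in the others it alternates with \<open>c\<close>. In case
    5 the counts of \<open>a\<close>, \<open>b\<close> and \<open>x\<close> agree in every
    prefix.\<close>
  consider (1) "leads a x w" "leads x b w" "leads d a w" "leads d b w"
    | (2) "leads a x w" "leads x b w" "leads a d w" "leads b d w"
    | (3) "leads a x w" "leads b x w"
    | (4) "leads x a w" "leads x b w"
    | (5) "leads x a w" "leads b x w"
    using xa xb d by blast
  then show ?thesis
  proof cases
    case 1
    have "leads d x w" unfolding leads_def
    proof
      fix n show "count_list (take n w) x \<le> count_list (take n w) d \<and>
          count_list (take n w) d \<le> Suc (count_list (take n w) x)"
        using le[OF 1(1), of n] le[OF 1(2), of n] le[OF 1(3), of n] le[OF 1(4), of n] by linarith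
    qed
    then show ?thesis by blast
  next
    case 2
    have "leads x d w" unfolding leads_def
    proof
      fix n show "count_list (take n w) d \<le> count_list (take n w) x \<and>
          count_list (take n w) x \<le> Suc (count_list (take n w) d)"
        using le[OF 2(1), of n] le[OF 2(2), of n] le[OF 2(3), of n] le[OF 2(4), of n] by linarith
    qed
    then show ?thesis by blast
  next
    case 3
    have "leads c x w" unfolding leads_def
    proof
      fix n show "count_list (take n w) x \<le> count_list (take n w) c \<and>
          count_list (take n w) c \<le> Suc (count_list (take n w) x)"
        using le[OF 3(1), of n] le[OF 3(2), of n] le[OF ac, of n] le[OF cb, of n] by linarith
    qed
    then show ?thesis by blast
  next
    case 4
    have "leads x c w" unfolding leads_def
    proof
      fix n show "count_list (take n w) c \<le> count_list (take n w) x \<and>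
          count_list (take n w) x \<le> Suc (count_list (take n w) c)"
        using le[OF 4(1), of n] le[OF 4(2), of n] le[OF ac, of n] le[OF cb, of n] by linarith
    qed
    then show ?thesis by blast
  next
    case 5
    have "leads x c w" unfolding leads_def
    proof
      fix n show "count_list (take n w) c \<le> count_list (take n w) x \<and>
          count_list (take n w) x \<le> Suc (count_list (take n w) c)"
        using le[OF 5(1), of n] le[OF 5(2), of n] le[OF ac, of n] le[OF cb, of n] by linarith
    qed
    then show ?thesis by blast
  qed
qed

section \<open>First occurrences as positions in the cyclic order\<close>

definition first_occ :: "'a list \<Rightarrow> 'a \<Rightarrow> nat" where
  "first_occ w x = (LEAST n. n < length w \<and> w ! n = x)"

lemma first_occ:
  assumes "x \<in> set w"
  shows "first_occ w x < length w" "w ! first_occ w x = x"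
    "\<And>n. n < first_occ w x \<Longrightarrow> w ! n \<noteq> x"
proof -
  have "\<exists>n. n < length w \<and> w ! n = x" using assms by (metis in_set_conv_nth)
  from LeastI_ex[OF this]
  show "first_occ w x < length w" "w ! first_occ w x = x"
    unfolding first_occ_def by auto
  show "w ! n \<noteq> x" if "n < first_occ w x" for n
    using not_less_Least[of n "\<lambda>n. n < length w \<and> w ! n = x"] that \<open>first_occ w x < length w\<close>
    unfolding first_occ_def by simp
qed

lemma first_occ_inj: "x \<in> set w \<Longrightarrow> y \<in> set w \<Longrightarrow> first_occ w x = first_occ w y \<Longrightarrow> x = y"
  by (metis first_occ(2))

text \<open>Otherwise the prefix ending with the first \<open>x\<close> would contain
  \<open>x\<close> but no \<open>y\<close>. Hence first occurrences decide which of two alternating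
  letters leads, and they list pairwise alternating letters in their cyclic order, cut open at the
  start of the word.\<close>

lemma leads_first_occ:
  assumes "x \<in> set w" "y \<in> set w" "leads y x w"
  shows "first_occ w y \<le> first_occ w x"
proof (rule ccontr)
  assume "\<not> ?thesis"
  then have lt: "first_occ w x < first_occ w y" by simp
  let ?n = "Suc (first_occ w x)"
  have "y \<notin> set (take ?n w)"
    using first_occ[OF assms(2)] lt by (auto simp: in_set_conv_nth)
  moreover have "x \<in> set (take ?n w)"
    using first_occ(1,2)[OF assms(1)] by (metis in_set_conv_nth length_take lessI min_less_iff_conj nth_take)
  ultimately show False
    using assms(3)[unfolded leads_def, rule_format, of ?n] by (metis bot_nat_0.extremum_uniqueI count_list_0_iff)
qed

lemma alternate_first_occ:
  assumes "x \<in> set w" "y \<in> set w" "alternate x y w" "first_occ w x < first_occ w y"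
  shows "leads x y w"
  using assms leads_first_occ[of x w y] by (metis alternate_iff_leads less_irrefl not_le)

text \<open>Crossing chords: with the positions placed on a circle, the chord \<open>cd\<close>
  meets the chord \<open>ab\<close>.\<close>

definition separates :: "nat \<Rightarrow> nat \<Rightarrow> nat \<Rightarrow> nat \<Rightarrow> bool" where
  "separates c d a b \<longleftrightarrow>
    (min a b < c \<and> c < max a b \<and> (d < min a b \<or> max a b < d)) \<or>
    (min a b < d \<and> d < max a b \<and> (c < min a b \<or> max a b < c))"

lemma separates_commute: "separates c d a b \<longleftrightarrow> separates c d b a"
  by (auto simp: separates_def min.commute max.commute)

text \<open>The first occurrences fix who leads whom among the four clique letters, which gives the
  situation of \<open>leads_separated\<close>.\<close>

lemma alternate_separated:
  assumes "{a, b, c, d} \<subseteq> set w"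
    and clique: "\<And>u v. u \<in> {a, b, c, d} \<Longrightarrow> v \<in> {a, b, c, d} \<Longrightarrow> u \<noteq> v \<Longrightarrow> alternate u v w"
    and x: "x \<notin> {a, b, c, d}" "alternate x a w" "alternate x b w"
    and sep: "separates (first_occ w c) (first_occ w d) (first_occ w a) (first_occ w b)"
  shows "alternate x c w \<or> alternate x d w"
proof -
  have l: "leads u v w" if "u \<in> {a, b, c, d}" "v \<in> {a, b, c, d}" "first_occ w u < first_occ w v" for u v
    using that assms(1) clique[of u v] alternate_first_occ[of u w v] by (metis less_irrefl subsetD)
  \<comment> \<open>The normal form: \<open>c'\<close> lies between \<open>a'\<close> and
    \<open>b'\<close>, and \<open>d'\<close> comes before or after all three. The orders allowed by
    \<open>separates\<close> are renamings of it.\<close>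
  have *: "alternate x c w \<or> alternate x d w"
    if "{a, b, c, d} = {a', b', c', d'}" "{c, d} = {c', d'}"
       "alternate x a' w" "alternate x b' w"
       "first_occ w a' < first_occ w c'" "first_occ w c' < first_occ w b'"
       "first_occ w d' < first_occ w a' \<or> first_occ w b' < first_occ w d'" for a' b' c' d'
  proof -
    have in4: "a' \<in> {a,b,c,d}" "b' \<in> {a,b,c,d}" "c' \<in> {a,b,c,d}" "d' \<in> {a,b,c,d}"
      using that(1) by auto
    have nx: "x \<noteq> a'" "x \<noteq> b'" "x \<noteq> c'" "x \<noteq> d'" using in4 x(1) by auto
    have "leads d' a' w \<and> leads d' b' w \<or> leads a' d' w \<and> leads b' d' w"
      using that(5-7) l in4 by (meson less_trans)
    moreover have "leads a' b' w" "leads a' c' w" "leads c' b' w"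
      using that(5-6) l in4 by (meson less_trans)+
    ultimately have "leads c' x w \<or> leads x c' w \<or> leads d' x w \<or> leads x d' w"
      using leads_separated[of a' b' w c' d' x] that(3,4) nx alternate_iff_leads by metis
    then have "alternate x c' w \<or> alternate x d' w"
      using nx alternate_iff_leads by metis
    then show ?thesis using that(2) by (metis doubleton_eq_iff)
  qed
  have perm: "{a, b, c, d} = {a, b, d, c}" "{a, b, c, d} = {b, a, c, d}"
      "{a, b, c, d} = {b, a, d, c}" "{c, d} = {d, c}" by auto
  have "first_occ w a < first_occ w b \<or> first_occ w b < first_occ w a"
    using sep by (cases "first_occ w a" "first_occ w b" rule: linorder_cases) (auto simp: separates_def)
  then show ?thesis
  proof
    assume "first_occ w a < first_occ w b"
    with sep have "first_occ w a < first_occ w c \<and> first_occ w c < first_occ w b \<and>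
        (first_occ w d < first_occ w a \<or> first_occ w b < first_occ w d) \<or>
      first_occ w a < first_occ w d \<and> first_occ w d < first_occ w b \<and>
        (first_occ w c < first_occ w a \<or> first_occ w b < first_occ w c)"
      by (simp add: separates_def)
    then show ?thesis
      using *[OF refl refl x(2,3)] *[OF perm(1,4) x(2,3)] by blast
  next
    assume "first_occ w b < first_occ w a"
    with sep have "first_occ w b < first_occ w c \<and> first_occ w c < first_occ w a \<and>
        (first_occ w d < first_occ w b \<or> first_occ w a < first_occ w d) \<or>
      first_occ w b < first_occ w d \<and> first_occ w d < first_occ w a \<and>
        (first_occ w c < first_occ w b \<or> first_occ w a < first_occ w c)"
      by (simp add: separates_def)
    then show ?thesis
      using *[OF perm(2) refl x(3,2)] *[OF perm(3,4) x(3,2)] by blast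
  qed
qed

text \<open>For distinct positions \<open>a < c \<longleftrightarrow> c < b\<close> says that
  \<open>c\<close> lies between \<open>a\<close> and \<open>b\<close>, whichever of the two is
  smaller; this removes \<open>min\<close> and \<open>max\<close>.\<close>

lemma separates_iff:
  assumes "distinct [a, b, c, d]"
  shows "separates c d a b \<longleftrightarrow> (a < c \<longleftrightarrow> c < b) \<noteq> (a < d \<longleftrightarrow> d < b)"
proof (cases "a < b")
  case True
  then show ?thesis using assms unfolding separates_def by auto
next
  case False
  with assms have "b < a" by auto
  then show ?thesis using assms unfolding separates_def by auto
qed

text \<open>Of four points on a circle one is opposite to \<open>p\<close>, and its chord to
  \<open>p\<close> crosses the chord of the other two.\<close>

lemma separates_exists:
  assumes "distinct [p, a, b, c]"
  shows "separates b c p a \<or> separates a c p b \<or> separates a b p c"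
proof -
  have "b < a \<longleftrightarrow> \<not> a < b" "c < a \<longleftrightarrow> \<not> a < c" "c < b \<longleftrightarrow> \<not> b < c"
    using assms by auto
  then show ?thesis
    using assms separates_iff[of p a b c] separates_iff[of p b a c] separates_iff[of p c a b] by auto
qed

subsection \<open>The forbidden graphs are not word-representable\<close>

text \<open>In both graphs an arc is the pair of its ends, so the vertex map of an isomorphism
  determines its action on arcs as \<open>map_prod f f\<close>. Below only embeddings of vertices
  are handled.\<close>

lemma contains_induced_iff:
  assumes H: "pair_graph H" and G: "pair_graph G"
  shows "contains_induced G H \<longleftrightarrow>
    (\<exists>f. inj_on f (pverts H) \<and> f ` pverts H \<subseteq> pverts G \<and>
      (\<forall>u \<in> pverts H. \<forall>v \<in> pverts H. (f u, f v) \<in> parcs G \<longleftrightarrow> (u, v) \<in> parcs H))"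
proof -
  interpret H: pair_graph H by fact
  interpret G: pair_graph G by fact
  have wf: "u \<in> pverts H \<and> v \<in> pverts H" if "(u, v) \<in> parcs H" for u v
    using that H.in_arcsD1 H.in_arcsD2 by auto
  show ?thesis
  proof
    assume "contains_induced G H"
    then obtain S h where S: "S \<subseteq> pverts G"
      and h: "pre_digraph.digraph_isomorphism (with_proj H) h"
      and eq: "induce_subgraph (with_proj G) S = app_iso h (with_proj H)"
      unfolding contains_induced_def digraph_iso_def by blast
    let ?f = "iso_verts h"
    from h have inj: "inj_on ?f (pverts H)"
      and arc: "\<And>a. a \<in> parcs H \<Longrightarrow>
        ?f (fst a) = iso_tail h (iso_arcs h a) \<and> ?f (snd a) = iso_head h (iso_arcs h a)"
      by (auto simp: pre_digraph.digraph_isomorphism_def)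
    from eq have verts: "S = ?f ` pverts H"
      and arcs: "{a \<in> parcs G. fst a \<in> S \<and> snd a \<in> S} = iso_arcs h ` parcs H"
      and ends: "iso_tail h = fst" "iso_head h = snd"
      by (auto simp: induce_subgraph_def app_iso_def)
    have iso_arcs: "iso_arcs h (u, v) = (?f u, ?f v)" if "(u, v) \<in> parcs H" for u v
      using arc[OF that] ends by (metis fst_conv snd_conv prod.collapse)
    have "(?f u, ?f v) \<in> parcs G \<longleftrightarrow> (u, v) \<in> parcs H" if uv: "u \<in> pverts H" "v \<in> pverts H" for u v
    proof
      assume "(?f u, ?f v) \<in> parcs G"
      then have "(?f u, ?f v) \<in> iso_arcs h ` parcs H"
        using uv verts arcs by auto
      then obtain u' v' where "(u', v') \<in> parcs H" "?f u = ?f u'" "?f v = ?f v'"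
        using iso_arcs by auto
      then show "(u, v) \<in> parcs H" using inj uv wf by (metis inj_onD)
    next
      assume "(u, v) \<in> parcs H"
      then have "(?f u, ?f v) \<in> iso_arcs h ` parcs H" using iso_arcs by force
      then show "(?f u, ?f v) \<in> parcs G" using arcs by blast
    qed
    then show "\<exists>f. inj_on f (pverts H) \<and> f ` pverts H \<subseteq> pverts G \<and>
      (\<forall>u \<in> pverts H. \<forall>v \<in> pverts H. (f u, f v) \<in> parcs G \<longleftrightarrow> (u, v) \<in> parcs H)"
      using inj S verts by blast
  next
    assume "\<exists>f. inj_on f (pverts H) \<and> f ` pverts H \<subseteq> pverts G \<and>
      (\<forall>u \<in> pverts H. \<forall>v \<in> pverts H. (f u, f v) \<in> parcs G \<longleftrightarrow> (u, v) \<in> parcs H)"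
    then obtain f where inj: "inj_on f (pverts H)" and sub: "f ` pverts H \<subseteq> pverts G"
      and arcs: "\<And>u v. u \<in> pverts H \<Longrightarrow> v \<in> pverts H \<Longrightarrow> (f u, f v) \<in> parcs G \<longleftrightarrow> (u, v) \<in> parcs H"
      by blast
    define h where "h = \<lparr>iso_verts = f, iso_arcs = map_prod f f, iso_head = snd, iso_tail = fst\<rparr>"
    have "inj_on (map_prod f f) (parcs H)"
      using inj wf by (auto simp: inj_on_def)
    then have "pre_digraph.digraph_isomorphism (with_proj H) h"
      using inj H.wf_digraph_axioms
      by (auto simp: pre_digraph.digraph_isomorphism_def h_def)
    moreover have "{e \<in> parcs G. fst e \<in> f ` pverts H \<and> snd e \<in> f ` pverts H} = map_prod f f ` parcs H"
    proof (intro equalityI subsetI)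
      fix e assume "e \<in> {e \<in> parcs G. fst e \<in> f ` pverts H \<and> snd e \<in> f ` pverts H}"
      then obtain u v where "e = (f u, f v)" "u \<in> pverts H" "v \<in> pverts H" "e \<in> parcs G"
        by (cases e) auto
      then show "e \<in> map_prod f f ` parcs H" using arcs by (force simp: image_iff)
    next
      fix e assume "e \<in> map_prod f f ` parcs H"
      then show "e \<in> {e \<in> parcs G. fst e \<in> f ` pverts H \<and> snd e \<in> f ` pverts H}"
        using arcs wf by auto
    qed
    then have "induce_subgraph (with_proj G) (f ` pverts H) = app_iso h (with_proj H)"
      by (simp add: induce_subgraph_def app_iso_def h_def)
    ultimately show "contains_induced G H"
      using sub unfolding contains_induced_def digraph_iso_def by blast
  qed
qed

section \<open>Adjacency in the forbidden graphs\<close>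

lemma A_graph_verts:
  "pverts (A_graph (Suc r)) = insert Apex (Clq ` {1..r}) \<union> Tip ` {1..r}"
  unfolding A_graph_def K_triangle_def undirected_def by auto

lemma A_graph_clique:
  assumes "u \<in> insert Apex (Clq ` {1..r})" "v \<in> insert Apex (Clq ` {1..r})" "u \<noteq> v"
  shows "(u, v) \<in> parcs (A_graph (Suc r))"
  using assms unfolding A_graph_def K_triangle_def undirected_def
  by (elim insertE imageE) (simp_all add: clique_arcs_def)

lemma A_graph_tips: "(Tip i, Tip j) \<notin> parcs (A_graph (Suc r))"
  unfolding A_graph_def K_triangle_def undirected_def by (auto simp: clique_arcs_def)

text \<open>With the index \<open>Suc r\<close> the cycle has \<open>r\<close> vertices; the
  conditional is the cyclic successor of \<open>i\<close>.\<close>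

lemma A_graph_tip:
  assumes "i \<in> {1..r}" "j \<in> {1..r}"
  shows "(Tip i, Clq j) \<in> parcs (A_graph (Suc r)) \<longleftrightarrow> j = i \<or> j = (if i = r then 1 else Suc i)"
    "(Tip i, Apex) \<notin> parcs (A_graph (Suc r))"
  using assms unfolding A_graph_def K_triangle_def undirected_def
  by (auto simp: clique_arcs_def)

lemma T2_verts: "pverts T2 = Clq ` {1, 2, 3, 4} \<union> Tip ` {1, 2, 3}"
proof -
  have "{1..4} = {1, 2, 3, 4 :: nat}" "{1..3} = {1, 2, 3 :: nat}" by auto
  then show ?thesis by (simp add: T2_def undirected_def)
qed

lemma T2_clique: "i \<in> {1, 2, 3, 4} \<Longrightarrow> j \<in> {1, 2, 3, 4} \<Longrightarrow> i \<noteq> j \<Longrightarrow> (Clq i, Clq j) \<in> parcs T2"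
  unfolding T2_def undirected_def clique_arcs_def by auto

lemma T2_tips: "(Tip i, Tip j) \<notin> parcs T2"
  unfolding T2_def undirected_def clique_arcs_def by auto

lemma T2_tip:
  "(Tip i, Clq j) \<in> parcs T2 \<longleftrightarrow> i \<in> {1, 2, 3} \<and> (j = 2 \<or> j = (if i = 1 then 1 else Suc i))"
  unfolding T2_def undirected_def clique_arcs_def by auto

text \<open>By \<open>alternate_separated\<close>, separation would create an edge from
  \<open>x\<close> to \<open>c\<close> or \<open>d\<close>. Both forbidden graphs are excluded in
  this way, with a tip in the role of \<open>x\<close>.\<close>

lemma word_representable_not_separates:
  assumes w: "set w = pverts G"
      "\<And>x y. x \<in> pverts G \<Longrightarrow> y \<in> pverts G \<Longrightarrow> x \<noteq> y \<Longrightarrow> alternate x y w \<longleftrightarrow> (x, y) \<in> parcs G"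
    and clique: "{a, b, c, d} \<subseteq> pverts G"
      "\<And>u v. u \<in> {a, b, c, d} \<Longrightarrow> v \<in> {a, b, c, d} \<Longrightarrow> u \<noteq> v \<Longrightarrow> (u, v) \<in> parcs G"
    and x: "x \<in> pverts G - {a, b, c, d}" "(x, a) \<in> parcs G" "(x, b) \<in> parcs G"
      "(x, c) \<notin> parcs G" "(x, d) \<notin> parcs G"
  shows "\<not> separates (first_occ w c) (first_occ w d) (first_occ w a) (first_occ w b)"
proof
  assume sep: "separates (first_occ w c) (first_occ w d) (first_occ w a) (first_occ w b)"
  have "alternate x c w \<or> alternate x d w"
  proof (rule alternate_separated[OF _ _ _ _ _ sep])
    show "{a, b, c, d} \<subseteq> set w" using w(1) clique(1) by simp
    show "alternate u v w" if "u \<in> {a, b, c, d}" "v \<in> {a, b, c, d}" "u \<noteq> v" for u v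
      using that clique w(2) by (meson subsetD)
  qed (use x clique(1) w(2) in auto)
  then show False using x clique(1) w(2)[of x c] w(2)[of x d] by auto
qed

text \<open>In the cyclic order some clique vertex is opposite to the centre \<open>Clq 2\<close>,
  but the three tips forbid this for \<open>Clq 1\<close>, \<open>Clq 3\<close> and
  \<open>Clq 4\<close> in turn.\<close>

lemma T2_not_word_representable:
  assumes G: "pair_graph G" and T2: "contains_induced G T2"
  shows "\<not> word_representable G"
proof
  assume "word_representable G"
  then obtain w where w: "set w = pverts G"
      "\<And>x y. x \<in> pverts G \<Longrightarrow> y \<in> pverts G \<Longrightarrow> x \<noteq> y \<Longrightarrow> alternate x y w \<longleftrightarrow> (x, y) \<in> parcs G"
    unfolding word_representable_def by blast
  obtain f where inj: "inj_on f (pverts T2)" and sub: "f ` pverts T2 \<subseteq> pverts G"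
    and arcs: "\<And>u v. u \<in> pverts T2 \<Longrightarrow> v \<in> pverts T2 \<Longrightarrow> (f u, f v) \<in> parcs G \<longleftrightarrow> (u, v) \<in> parcs T2"
    using T2 contains_induced_iff[OF pair_graph_T2 G] by blast
  have V: "pverts T2 = {Clq 1, Clq 2, Clq 3, Clq 4, Tip 1, Tip 2, Tip 3}"
    using T2_verts by auto
  define q where "q i = first_occ w (f (Clq i))" for i
  \<comment> \<open>The tip \<open>t\<close> has the neighbours 2 and \<open>b\<close>; the
    remaining clique vertices are \<open>c\<close> and \<open>d\<close>.\<close>
  have ns: "\<not> separates (q c) (q d) (q 2) (q b)"
    if "(t, b, c, d) \<in> {(1,1,3,4), (2,3,1,4), (3,4,1,3)}" for t b c d :: nat
    unfolding q_def
  proof (rule word_representable_not_separates[OF w, of _ _ _ _ "f (Tip t)"])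
    have V4: "Tip t \<in> pverts T2" "{Clq 2, Clq b, Clq c, Clq d} \<subseteq> pverts T2"
      using that V by auto
    then show "{f (Clq 2), f (Clq b), f (Clq c), f (Clq d)} \<subseteq> pverts G"
      using sub by auto
    show "(u, v) \<in> parcs G" if uv: "u \<in> {f (Clq 2), f (Clq b), f (Clq c), f (Clq d)}"
        "v \<in> {f (Clq 2), f (Clq b), f (Clq c), f (Clq d)}" "u \<noteq> v" for u v
    proof -
      obtain i j where ij: "u = f (Clq i)" "v = f (Clq j)" "i \<in> {2, b, c, d}" "j \<in> {2, b, c, d}"
        using uv(1,2) by auto
      then have "Clq i \<in> pverts T2" "Clq j \<in> pverts T2" "i \<noteq> j" "i \<in> {1, 2, 3, 4}" "j \<in> {1, 2, 3, 4}"
        using V4 \<open>u \<noteq> v\<close> \<open>(t, b, c, d) \<in> _\<close> by auto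
      then show ?thesis
        using arcs[of "Clq i" "Clq j"] ij T2_clique by simp
    qed
    show "f (Tip t) \<in> pverts G - {f (Clq 2), f (Clq b), f (Clq c), f (Clq d)}"
      using V4 sub inj by (auto dest!: inj_onD)
    have *: "(f (Tip t), f (Clq i)) \<in> parcs G \<longleftrightarrow> i = 2 \<or> i = b" if "i \<in> {2, b, c, d}" for i
      using arcs[of "Tip t" "Clq i"] V4 that \<open>(t, b, c, d) \<in> _\<close>
      by (auto simp: T2_tip)
    show "(f (Tip t), f (Clq 2)) \<in> parcs G" "(f (Tip t), f (Clq b)) \<in> parcs G" using * by auto
    show "(f (Tip t), f (Clq c)) \<notin> parcs G" "(f (Tip t), f (Clq d)) \<notin> parcs G"
      using *[of c] *[of d] that by auto
  qed
  have "q i \<noteq> q j" if "i \<in> {1, 2, 3, 4}" "j \<in> {1, 2, 3, 4}" "i \<noteq> j" for i j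
  proof -
    have "Clq i \<in> pverts T2" "Clq j \<in> pverts T2" using that V by auto
    moreover have "f (Clq i) \<noteq> f (Clq j)" using inj that(3) calculation by (auto dest: inj_onD)
    ultimately show ?thesis using first_occ_inj sub w(1) unfolding q_def by (metis image_subset_iff)
  qed
  from this[of 1 2] this[of 1 3] this[of 1 4] this[of 2 3] this[of 2 4] this[of 3 4]
  have "q 1 \<noteq> q 2" "q 1 \<noteq> q 3" "q 1 \<noteq> q 4" "q 2 \<noteq> q 3" "q 2 \<noteq> q 4" "q 3 \<noteq> q 4" by auto
  moreover have "\<not> separates (q 3) (q 4) (q 2) (q 1)" "\<not> separates (q 1) (q 4) (q 2) (q 3)"
      "\<not> separates (q 1) (q 3) (q 2) (q 4)"
    using ns[of 1 1 3 4] ns[of 2 3 1 4] ns[of 3 4 1 3] by auto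
  ultimately show False
    using separates_exists[of "q 2" "q 1" "q 3" "q 4"] by auto
qed

text \<open>Read cyclically from the apex, the vertex of the cycle that comes last is separated from
  one of its two neighbours by the other one and the apex.\<close>

lemma A_graph_not_word_representable:
  assumes G: "pair_graph G" and l: "l \<ge> 4" and A: "contains_induced G (A_graph l)"
  shows "\<not> word_representable G"
proof
  assume "word_representable G"
  then obtain w where w: "set w = pverts G"
      "\<And>x y. x \<in> pverts G \<Longrightarrow> y \<in> pverts G \<Longrightarrow> x \<noteq> y \<Longrightarrow> alternate x y w \<longleftrightarrow> (x, y) \<in> parcs G"
    unfolding word_representable_def by blast
  obtain r where r: "l = Suc r" "r \<ge> 3" using l by (cases l) auto
  let ?H = "A_graph (Suc r)"
  obtain f where inj: "inj_on f (pverts ?H)" and sub: "f ` pverts ?H \<subseteq> pverts G"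
    and arcs: "\<And>u v. u \<in> pverts ?H \<Longrightarrow> v \<in> pverts ?H \<Longrightarrow> (f u, f v) \<in> parcs G \<longleftrightarrow> (u, v) \<in> parcs ?H"
    using A contains_induced_iff[OF pair_graph_A_graph[OF l] G] r(1) by blast
  note V = A_graph_verts[of r]
  define q where "q v = first_occ w (f v)" for v
  \<comment> \<open>The tip \<open>i\<close> sits on the cycle edge \<open>ij\<close>, so it is
    joined neither to a third cycle vertex \<open>k\<close> nor to the apex.\<close>
  have ns: "\<not> separates (q (Clq k)) (q Apex) (q (Clq i)) (q (Clq j))"
    if i: "i \<in> {1..r}" and j: "j = (if i = r then 1 else Suc i)" and k: "k \<in> {1..r} - {i, j}" for i j k
    unfolding q_def
  proof (rule word_representable_not_separates[OF w, of _ _ _ _ "f (Tip i)"])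
    have j': "j \<in> {1..r}" using i j r(2) by auto
    let ?C = "{Clq i, Clq j, Clq k, Apex}"
    have V4: "Tip i \<in> pverts ?H" "?C \<subseteq> pverts ?H"
      using i j' k V by auto
    then show "{f (Clq i), f (Clq j), f (Clq k), f Apex} \<subseteq> pverts G"
      using sub by auto
    show "(u, v) \<in> parcs G" if uv: "u \<in> {f (Clq i), f (Clq j), f (Clq k), f Apex}"
        "v \<in> {f (Clq i), f (Clq j), f (Clq k), f Apex}" "u \<noteq> v" for u v
    proof -
      obtain u' v' where uv': "u = f u'" "v = f v'" "u' \<in> ?C" "v' \<in> ?C"
        using uv(1,2) by auto
      moreover have "?C \<subseteq> insert Apex (Clq ` {1..r})" using i j' k by auto
      ultimately have "(u', v') \<in> parcs ?H" using uv(3) by (intro A_graph_clique) auto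
      then show ?thesis using arcs uv' V4 by (metis subsetD)
    qed
    show "f (Tip i) \<in> pverts G - {f (Clq i), f (Clq j), f (Clq k), f Apex}"
      using V4 sub inj by (auto dest!: inj_onD)
    show "(f (Tip i), f (Clq i)) \<in> parcs G" "(f (Tip i), f (Clq j)) \<in> parcs G"
        "(f (Tip i), f (Clq k)) \<notin> parcs G" "(f (Tip i), f Apex) \<notin> parcs G"
      using arcs V4 A_graph_tip[OF i i] A_graph_tip[OF i j'] A_graph_tip[OF i, of k] j k
      by (auto split: if_splits)
  qed
  have q_inj: "q u \<noteq> q v" if "u \<in> pverts ?H" "v \<in> pverts ?H" "u \<noteq> v" for u v
  proof -
    have "f u \<noteq> f v" using inj that by (auto dest: inj_onD)
    then show ?thesis using first_occ_inj sub w(1) that unfolding q_def by (metis image_subset_iff)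
  qed
  \<comment> \<open>Positions before the apex are moved up by \<open>length w\<close>, so
    \<open>g\<close> orders the cycle vertices cyclically as read from the apex.\<close>
  define g where "g i = (if q (Clq i) < q Apex then q (Clq i) + length w else q (Clq i))" for i
  have len: "q (Clq i) < length w" if "i \<in> {1..r}" for i
  proof -
    have "Clq i \<in> pverts ?H" using that V by simp
    then have "f (Clq i) \<in> set w" using sub w(1) by (simp add: image_subset_iff)
    then show ?thesis unfolding q_def by (rule first_occ(1))
  qed
  have "Max (g ` {1..r}) \<in> g ` {1..r}" using r(2) by (intro Max_in) auto
  then obtain M where M_max: "M \<in> {1..r}" "g M = Max (g ` {1..r})" by auto
  have M: "M \<in> {1..r}" "\<And>i. i \<in> {1..r} \<Longrightarrow> g i \<le> g M"
    using M_max by auto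
  \<comment> \<open>Read from the apex the order is \<open>i\<close>, \<open>j\<close>,
    \<open>M\<close>, so the chord from \<open>j\<close> to the apex crosses the chord from
    \<open>i\<close> to \<open>M\<close>.\<close>
  have contra: False if ij: "i \<in> {1..r}" "j \<in> {1..r}" "i \<noteq> M" "j \<noteq> M" "g i < g j"
    and nsep: "\<not> separates (q (Clq j)) (q Apex) (q (Clq i)) (q (Clq M))" for i j
  proof -
    have "i \<noteq> j" using ij(5) by auto
    then have "q (Clq i) \<noteq> q (Clq j)" "q (Clq i) \<noteq> q (Clq M)" "q (Clq j) \<noteq> q (Clq M)"
        "q (Clq i) \<noteq> q Apex" "q (Clq j) \<noteq> q Apex" "q (Clq M) \<noteq> q Apex"
      using ij M(1) by (simp_all add: q_inj V)
    \<comment> \<open>Positions are below \<open>length w\<close>, so a shifted and an unshifted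
      value never coincide.\<close>
    moreover have "g j < g M"
      using calculation(3) M(2)[OF ij(2)] len[OF ij(2)] len[OF M(1)]
      unfolding g_def by (simp split: if_splits)
    ultimately show False
      using ij(5) nsep len[OF ij(1)] len[OF ij(2)] len[OF M(1)]
      unfolding g_def by (simp add: separates_iff split: if_splits)
  qed
  \<comment> \<open>The cyclic successor and predecessor of \<open>M\<close>, distinct because
    \<open>r \<ge> 3\<close>. Whichever comes first under \<open>g\<close> forms with
    \<open>M\<close> the cycle edge that is separated.\<close>
  define s p where "s = (if M = r then 1 else Suc M)" and "p = (if M = 1 then r else M - 1)"
  have sp: "s \<in> {1..r}" "p \<in> {1..r}" "s \<noteq> M" "p \<noteq> M" "s \<noteq> p" "M = (if p = r then 1 else Suc p)"
    using M(1) r(2) by (auto simp: s_def p_def)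
  have "g s \<noteq> g p"
    using q_inj[of "Clq s" "Clq p"] sp(1,2,5) len[of s] len[of p] by (simp add: V g_def split: if_splits)
  then consider "g s < g p" | "g p < g s" by linarith
  then show False
  proof cases
    case 1
    have "\<not> separates (q (Clq p)) (q Apex) (q (Clq M)) (q (Clq s))"
      using ns[OF M(1) s_def, of p] sp by auto
    then show False using contra[OF sp(1,2,3,4) 1] separates_commute by metis
  next
    case 2
    have "\<not> separates (q (Clq s)) (q Apex) (q (Clq p)) (q (Clq M))"
      using ns[OF sp(2,6), of s] sp by auto
    then show False using contra[OF sp(2,1,4,3) 2] by blast
  qed
qed

subsection \<open>Arranging a graph of maximum degree two cyclically\<close>

definition consecutive :: "'a list \<Rightarrow> 'a \<Rightarrow> 'a \<Rightarrow> bool" where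
  "consecutive p u v \<longleftrightarrow> (\<exists>i. Suc i < length p \<and> {u, v} = {p ! i, p ! Suc i})"

lemma consecutive_append1:
  assumes "consecutive p u v" shows "consecutive (p @ q) u v"
proof -
  obtain i where "Suc i < length p" "{u, v} = {p ! i, p ! Suc i}"
    using assms unfolding consecutive_def by blast
  then show ?thesis
    unfolding consecutive_def by (intro exI[of _ i]) (simp add: nth_append)
qed

lemma consecutive_append2:
  assumes "consecutive q u v" shows "consecutive (p @ q) u v"
proof -
  obtain i where "Suc i < length q" "{u, v} = {q ! i, q ! Suc i}"
    using assms unfolding consecutive_def by blast
  then show ?thesis
    unfolding consecutive_def by (intro exI[of _ "length p + i"]) (simp add: nth_append)
qed

locale graph_max_degree_2 =
  fixes E :: "'a \<Rightarrow> 'a \<Rightarrow> bool"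
  assumes sym: "E u v \<Longrightarrow> E v u"
    and irrefl: "\<not> E u u"
    and degree: "E u a \<Longrightarrow> E u b \<Longrightarrow> E u c \<Longrightarrow> a = b \<or> a = c \<or> b = c"
begin

text \<open>An interior vertex has two distinct neighbours on the path, and these exhaust its
  degree.\<close>

lemma path_interior:
  assumes "distinct p" "successively E p" "0 < i" "Suc i < length p" "E (p ! i) v"
  shows "consecutive p (p ! i) v"
proof -
  obtain j where j: "i = Suc j" using assms(3) by (cases i) auto
  have "E (p ! i) (p ! Suc i)" using successively_nth[OF assms(2,4)] .
  moreover have "E (p ! i) (p ! j)" using successively_nth[OF assms(2), of j] assms(4) j sym by simp
  moreover have "p ! j \<noteq> p ! Suc i" using assms(1,4) j by (simp add: nth_eq_iff_index_eq)
  ultimately consider "v = p ! j" | "v = p ! Suc i" using degree assms(5) by blast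
  then show ?thesis
  proof cases
    case 1
    then have "{p ! i, v} = {p ! j, p ! Suc j}" using j by auto
    then show ?thesis using assms(4) j unfolding consecutive_def by (metis Suc_lessD)
  next
    case 2
    then show ?thesis using assms(4) unfolding consecutive_def by blast
  qed
qed

lemma consecutive_commute: "consecutive p u v \<longleftrightarrow> consecutive p v u"
  unfolding consecutive_def insert_commute[of u v "{}"] ..

text \<open>By \<open>path_interior\<close>, an edge outside the path can only join its two
  ends.\<close>

lemma path_edge:
  assumes p: "distinct p" "successively E p" and uv: "u \<in> set p" "v \<in> set p" "E u v"
  shows "consecutive p u v \<or> {u, v} = {hd p, last p}"
proof -
  obtain i j where ij: "i < length p" "p ! i = u" "j < length p" "p ! j = v"
    using uv by (metis in_set_conv_nth)
  have "p \<noteq> []" using uv by auto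
  then have ends: "hd p = p ! 0" "last p = p ! (length p - 1)" by (simp_all add: hd_conv_nth last_conv_nth)
  consider "0 < i" "Suc i < length p" | "0 < j" "Suc j < length p"
    | "i \<in> {0, length p - 1}" "j \<in> {0, length p - 1}"
    using ij by fastforce
  then show ?thesis
  proof cases
    case 1
    then show ?thesis using path_interior[OF p 1] ij uv(3) by blast
  next
    case 2
    then show ?thesis using path_interior[OF p 2, of u] ij sym[OF uv(3)] consecutive_commute[of p v u] by simp
  next
    case 3
    have "i \<noteq> j" using ij uv(3) irrefl by auto
    then show ?thesis using 3 ij ends by auto
  qed
qed

text \<open>An edge leaving the path cannot start at an interior vertex, and one starting at an end
  would lengthen the path. So a longest path fills its component in \<open>S\<close>.\<close>

lemma maximal_path_closed:
  assumes p: "distinct p" "successively E p" "set p \<subseteq> S"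
    and max: "\<And>q. distinct q \<Longrightarrow> successively E q \<Longrightarrow> set q \<subseteq> S \<Longrightarrow> length q \<le> length p"
    and uv: "u \<in> set p" "v \<in> S" "E u v"
  shows "v \<in> set p"
proof (rule ccontr)
  assume v: "v \<notin> set p"
  obtain i where i: "i < length p" "p ! i = u" using uv(1) by (metis in_set_conv_nth)
  consider "0 < i" "Suc i < length p" | "i = 0" | "i = length p - 1" using i(1) by linarith
  then show False
  proof cases
    case 1
    then have "consecutive p u v" using path_interior[OF p(1,2) 1] i(2) uv(3) by blast
    then show False using v unfolding consecutive_def by (metis Suc_lessD doubleton_eq_iff nth_mem)
  next
    case 2
    have "p \<noteq> []" using i(1) by auto
    then have "successively E (v # p)"
      using p(2) sym[OF uv(3)] 2 i(2) by (simp add: successively_Cons hd_conv_nth)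
    then show False using max[of "v # p"] p v uv(2) by simp
  next
    case 3
    have "p \<noteq> []" using i(1) by auto
    then have "successively E (p @ [v])"
      using p(2) uv(3) 3 i(2) by (simp add: successively_append_iff last_conv_nth)
    then show False using max[of "p @ [v]"] p v uv(2) by simp
  qed
qed

text \<open>A longest path fills a component and no edge closes it to a cycle, so it can be put
  first, followed by an arrangement of the remaining vertices from the induction hypothesis.\<close>

lemma linear_arrangement:
  assumes "finite S"
    and acyclic: "\<And>p. distinct p \<Longrightarrow> successively E p \<Longrightarrow> set p \<subseteq> S \<Longrightarrow> length p \<ge> 3 \<Longrightarrow> \<not> E (last p) (hd p)"
  shows "\<exists>cs. distinct cs \<and> set cs = S \<and> (\<forall>u \<in> S. \<forall>v \<in> S. E u v \<longrightarrow> consecutive cs u v)"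
  using assms
proof (induction S rule: finite_psubset_induct)
  case (psubset S)
  show ?case
  proof (cases "S = {}")
    case False
    define P where "P p \<longleftrightarrow> distinct p \<and> successively E p \<and> set p \<subseteq> S" for p
    obtain s where s: "s \<in> S" using False by blast
    have "P [s]" using s by (simp add: P_def)
    moreover have "\<forall>p. P p \<longrightarrow> length p < Suc (card S)"
      using card_mono[OF psubset.hyps] by (metis P_def distinct_card less_Suc_eq_le)
    ultimately obtain p where p: "P p" and max: "\<And>q. P q \<Longrightarrow> length q \<le> length p"
      using ex_has_greatest_nat[of P "[s]" length "Suc (card S)"] by blast
    have "length p > 0" using max[OF \<open>P [s]\<close>] by (simp add: Suc_le_eq del: length_greater_0_conv)
    from p have p': "distinct p" "successively E p" "set p \<subseteq> S" by (auto simp: P_def)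
    have closed: "v \<in> set p" if "u \<in> set p" "v \<in> S" "E u v" for u v
      using maximal_path_closed[OF p' _ that] max by (simp add: P_def)
    have cons: "consecutive p u v" if "u \<in> set p" "v \<in> set p" "E u v" for u v
    proof (rule ccontr)
      assume nc: "\<not> consecutive p u v"
      then have uv: "{u, v} = {hd p, last p}" using path_edge[OF p'(1,2) that] by blast
      then have "E (last p) (hd p)" using that(3) sym by (metis doubleton_eq_iff)
      \<comment> \<open>Cycles have length at least 3; on a path of two vertices the edge between
        the ends is itself a pair of consecutive entries.\<close>
      then have "length p < 3" using psubset.prems[OF p'] by (meson not_less)
      moreover have "length p \<noteq> 1" using \<open>E (last p) (hd p)\<close> irrefl by (auto simp: length_Suc_conv)
      ultimately have "length p = 2" using \<open>length p > 0\<close> by linarith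
      then obtain a b where "p = [a, b]" by (auto simp: numeral_2_eq_2 length_Suc_conv)
      then have "Suc 0 < length p \<and> {u, v} = {p ! 0, p ! Suc 0}" using uv by simp
      then show False using nc unfolding consecutive_def by blast
    qed
    have "S - set p \<subset> S" using p'(3) \<open>length p > 0\<close> by (cases p) auto
    then obtain cs where cs: "distinct cs" "set cs = S - set p"
        "\<forall>u \<in> S - set p. \<forall>v \<in> S - set p. E u v \<longrightarrow> consecutive cs u v"
      using psubset.IH[of "S - set p"] psubset.prems by blast
    have "consecutive (p @ cs) u v" if "u \<in> S" "v \<in> S" "E u v" for u v
    proof (cases "u \<in> set p")
      case True
      then have "v \<in> set p" using closed that(2,3) by blast
      then show ?thesis using cons[OF True _ that(3)] by (simp add: consecutive_append1)
    next
      case False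
      then have "v \<notin> set p" using closed[of v u] that(1) sym[OF that(3)] by blast
      then show ?thesis using cs(3) False that by (simp add: consecutive_append2)
    qed
    then show ?thesis using cs p' by (intro exI[of _ "p @ cs"]) auto
  qed simp
qed

text \<open>A cycle, if there is one, exhausts \<open>S\<close>, and by \<open>path_edge\<close> its
  vertex sequence is the required order; otherwise the linear arrangement applies.\<close>

lemma cyclic_arrangement:
  assumes "finite S"
    and spanning: "\<And>p. distinct p \<Longrightarrow> successively E p \<Longrightarrow> set p \<subseteq> S \<Longrightarrow> length p \<ge> 3 \<Longrightarrow>
      E (last p) (hd p) \<Longrightarrow> set p = S"
  shows "\<exists>cs. distinct cs \<and> set cs = S \<and>
    (\<forall>u \<in> S. \<forall>v \<in> S. E u v \<longrightarrow> consecutive cs u v \<or> {u, v} = {hd cs, last cs})"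
proof (cases "\<exists>p. distinct p \<and> successively E p \<and> set p \<subseteq> S \<and> length p \<ge> 3 \<and> E (last p) (hd p)")
  case True
  then obtain p where "distinct p" "successively E p" "set p = S" using spanning by blast
  then show ?thesis using path_edge by blast
next
  case False
  then show ?thesis using linear_arrangement[OF assms(1)] by blast
qed

end

subsection \<open>Words given by occurrence times\<close>

text \<open>Words are built from real occurrence times, which leave room for a letter just before or
  after another. \<open>before\<close> takes the part of the count in a prefix, and
  \<open>interleave\<close> below that of \<open>leads\<close>.\<close>

definition before :: "real list \<Rightarrow> real \<Rightarrow> nat" where
  "before ts t = length (filter (\<lambda>s. s \<le> t) ts)"

lemma before_simps [simp]:
  "before [] t = 0"
  "before (s # ts) t = (if s \<le> t then Suc (before ts t) else before ts t)"
  by (simp_all add: before_def)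

definition interleave :: "real list \<Rightarrow> real list \<Rightarrow> bool" where
  "interleave ts us \<longleftrightarrow> (\<forall>t. before us t \<le> before ts t \<and> before ts t \<le> Suc (before us t))"

definition interleaved :: "real list \<Rightarrow> real list \<Rightarrow> bool" where
  "interleaved ts us \<longleftrightarrow> interleave ts us \<or> interleave us ts"

lemma interleaved_commute: "interleaved ts us \<Longrightarrow> interleaved us ts"
  by (auto simp: interleaved_def)

lemma filter_le_eq_take:
  fixes t :: real
  assumes "sorted xs"
  shows "\<exists>n. filter (\<lambda>s. s \<le> t) xs = take n xs"
  using assms
proof (induction xs)
  case (Cons a xs)
  show ?case
  proof (cases "a \<le> t")
    case True
    obtain n where "filter (\<lambda>s. s \<le> t) xs = take n xs" using Cons by auto
    then show ?thesis using True by (intro exI[of _ "Suc n"]) simp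
  next
    case False
    then have "filter (\<lambda>s. s \<le> t) (a # xs) = []" using Cons.prems by (auto simp: filter_empty_conv)
    then show ?thesis by (metis take0)
  qed
qed simp

text \<open>The extra claim \<open>t \<in> set xs\<close> serves the induction: it gives
  \<open>a \<le> t\<close> for a new head \<open>a\<close>, so the head passes the filter. With
  \<open>filter_le_eq_take\<close>, prefixes and time thresholds correspond.\<close>

lemma take_eq_filter_le:
  fixes xs :: "real list"
  assumes "sorted_wrt (<) xs"
  shows "\<exists>t. take n xs = filter (\<lambda>s. s \<le> t) xs \<and> (n > 0 \<and> xs \<noteq> [] \<longrightarrow> t \<in> set xs)"
  using assms
proof (induction xs arbitrary: n)
  case (Cons a xs)
  show ?case
  proof (cases n)
    case 0
    have "filter (\<lambda>s. s \<le> a - 1) (a # xs) = []"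
      using Cons.prems by (force simp: filter_empty_conv)
    then show ?thesis using 0 by (intro exI[of _ "a - 1"]) simp
  next
    case (Suc m)
    show ?thesis
    proof (cases "m > 0 \<and> xs \<noteq> []")
      case True
      then obtain t where t: "take m xs = filter (\<lambda>s. s \<le> t) xs" "t \<in> set xs"
        using Cons.IH[of m] Cons.prems by auto
      then have "a \<le> t" using Cons.prems by auto
      then show ?thesis using t Suc by (intro exI[of _ t]) simp
    next
      case False
      have "filter (\<lambda>s. s \<le> a) xs = []" using Cons.prems by (force simp: filter_empty_conv)
      then show ?thesis using False Suc by (intro exI[of _ a]) auto
    qed
  qed
qed simp

text \<open>The word is read off the sorted list of all times, each replaced by its owner. Its
  prefixes correspond to time thresholds, so \<open>leads\<close> turns into
  \<open>interleave\<close>.\<close>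

lemma word_of_times:
  fixes T :: "'a \<Rightarrow> real list"
  assumes V: "finite V"
    and T: "\<And>x. x \<in> V \<Longrightarrow> distinct (T x) \<and> T x \<noteq> []"
    and disj: "\<And>x y. x \<in> V \<Longrightarrow> y \<in> V \<Longrightarrow> x \<noteq> y \<Longrightarrow> set (T x) \<inter> set (T y) = {}"
  shows "\<exists>w. set w = V \<and>
    (\<forall>x \<in> V. \<forall>y \<in> V. x \<noteq> y \<longrightarrow> (alternate x y w \<longleftrightarrow> interleaved (T x) (T y)))"
proof -
  define U where "U = (\<Union>x \<in> V. set (T x))"
  define L where "L = sorted_list_of_set U"
  define owner where "owner t = (THE x. x \<in> V \<and> t \<in> set (T x))" for t
  define w where "w = map owner L"
  have "finite U" using V by (simp add: U_def)
  then have L: "set L = U" "sorted L" "sorted_wrt (<) L" "distinct L"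
    by (simp_all add: L_def)
  have owner: "owner t = x" if "x \<in> V" "t \<in> set (T x)" for t x
    unfolding owner_def using that disj by (intro the_equality) blast+
  have owner_iff: "owner t = x \<longleftrightarrow> t \<in> set (T x)" if "t \<in> U" "x \<in> V" for t x
    using that owner by (auto simp: U_def)
  have set_w: "set w = V"
  proof (intro equalityI subsetI)
    fix x assume "x \<in> V"
    then obtain t where "t \<in> set (T x)" using T[of x] by (cases "T x") auto
    then have "t \<in> U" "owner t = x" using \<open>x \<in> V\<close> owner by (auto simp: U_def)
    then show "x \<in> set w" using L(1) by (auto simp: w_def)
  next
    fix x assume "x \<in> set w"
    then show "x \<in> V" using L(1) owner by (auto simp: w_def U_def)
  qed
  have count: "count_list (map owner (filter (\<lambda>s. s \<le> t) L)) x = before (T x) t" if x: "x \<in> V" for x t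
  proof -
    have "count_list (map owner (filter (\<lambda>s. s \<le> t) L)) x =
        length (filter (\<lambda>s. owner s = x \<and> s \<le> t) L)"
      by (simp add: count_list_eq_length_filter filter_map o_def conj_commute eq_commute[of x])
    also have "\<dots> = card {s. s \<in> set L \<and> owner s = x \<and> s \<le> t}"
      using distinct_length_filter[OF L(4)] by (simp add: Int_def conj_ac)
    also have "{s. s \<in> set L \<and> owner s = x \<and> s \<le> t} = {s. s \<in> set (T x) \<and> s \<le> t}"
      using L(1) owner_iff[OF _ x] x by (auto simp: U_def)
    also have "card \<dots> = before (T x) t"
      using distinct_length_filter[of "T x"] T[OF x] by (simp add: before_def Int_def conj_ac)
    finally show ?thesis .
  qed
  have leads: "leads x y w \<longleftrightarrow> interleave (T x) (T y)" if "x \<in> V" "y \<in> V" for x y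
  proof
    assume l: "leads x y w"
    show "interleave (T x) (T y)"
      unfolding interleave_def
    proof
      fix t
      obtain n where "filter (\<lambda>s. s \<le> t) L = take n L" using filter_le_eq_take[OF L(2)] by blast
      then have "take n w = map owner (filter (\<lambda>s. s \<le> t) L)" by (simp add: w_def take_map)
      then show "before (T y) t \<le> before (T x) t \<and> before (T x) t \<le> Suc (before (T y) t)"
        using l[unfolded leads_def, rule_format, of n] count[OF that(1)] count[OF that(2)] by simp
    qed
  next
    assume i: "interleave (T x) (T y)"
    show "leads x y w"
      unfolding leads_def
    proof
      fix n
      obtain t where "take n L = filter (\<lambda>s. s \<le> t) L" using take_eq_filter_le[OF L(3)] by blast
      then have "take n w = map owner (filter (\<lambda>s. s \<le> t) L)" by (simp add: w_def take_map)
      then show "count_list (take n w) y \<le> count_list (take n w) x \<and>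
          count_list (take n w) x \<le> Suc (count_list (take n w) y)"
        using i[unfolded interleave_def, rule_format, of t] count[OF that(1)] count[OF that(2)] by simp
    qed
  qed
  show ?thesis
    using set_w leads by (intro exI[of _ w]) (simp add: alternate_iff_leads interleaved_def)
qed

text \<open>The time \<open>s\<close> refutes that \<open>ts\<close> leads, and the time
  \<open>t\<close> that \<open>us\<close> does.\<close>

lemma not_interleaved:
  assumes "before us s > before ts s \<or> before ts s > Suc (before us s)"
    and "before ts t > before us t \<or> before us t > Suc (before ts t)"
  shows "\<not> interleaved ts us"
  using assms unfolding interleaved_def interleave_def by (metis not_le)

section \<open>Occurrence patterns of two letters\<close>

lemma interleaved_abab: "a < b \<Longrightarrow> b < c \<Longrightarrow> c < d \<Longrightarrow> interleaved [a, c] [b, d]"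
  unfolding interleaved_def interleave_def by auto

lemma interleaved_ababa:
  "a < b \<Longrightarrow> b < c \<Longrightarrow> c < d \<Longrightarrow> d < e \<Longrightarrow> interleaved [a, c, e] [b, d]"
  unfolding interleaved_def interleave_def by auto

lemma not_interleaved_abba:
  "a < b \<Longrightarrow> b < c \<Longrightarrow> c < d \<Longrightarrow> \<not> interleaved [a, d] [b, c]"
  by (rule not_interleaved[of _ c _ a]) auto

lemma not_interleaved_abbab:
  "a < b \<Longrightarrow> b < c \<Longrightarrow> c < d \<Longrightarrow> c < e \<Longrightarrow> \<not> interleaved [a, d] [b, c, e]"
  by (rule not_interleaved[of _ c _ a]) auto

lemma not_interleaved_aabb:
  "a < b \<Longrightarrow> b < c \<Longrightarrow> c < d \<Longrightarrow> \<not> interleaved (a # b # ts) [c, d]"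
  by (rule not_interleaved[of _ b _ b]) auto

text \<open>Six letters beginning and ending with the same letter.\<close>

lemma not_interleaved_even:
  "a < a' \<Longrightarrow> a' < b' \<Longrightarrow> b < c' \<Longrightarrow> b' < c' \<Longrightarrow> c' < c \<Longrightarrow> \<not> interleaved [a, b, c] [a', b', c']"
  by (rule not_interleaved[of _ c' _ a]) auto

text \<open>The letter at position \<open>k\<close> of \<open>cs\<close> occurs at the times \<open>3(k+1)\<close> and \<open>3(k+1+m)\<close>,
  where \<open>m\<close> is the length of \<open>cs\<close>. A further letter with neighbourhood \<open>X\<close> occurs just after the
  time \<open>a\<close>, just before the time \<open>b\<close> and, if \<open>three\<close> holds, once more at the very end, the order
  at the end being the reverse of that of the first occurrences.\<close>

definition slot :: "'a list \<Rightarrow> 'a set \<Rightarrow> bool \<Rightarrow> nat \<Rightarrow> nat \<Rightarrow> bool" where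
  "slot cs X three a b \<longleftrightarrow>
    (if three then a < b \<and> b \<le> 3 * length cs + 1 \<and> (b \<le> 4 \<or> a \<ge> 5) \<and>
       (\<forall>k < length cs. cs ! k \<in> X \<longleftrightarrow> a < 3 * (k + 1) \<and> 3 * (k + 1) < b)
     else length cs \<ge> 3 \<and>
       (X = {cs ! 0, cs ! 1} \<and> a = 3 * length cs + 2 \<and> b = 3 * length cs + 7 \<or>
        X = {cs ! 0, cs ! (length cs - 1)} \<and> a = 4 \<and> b = 6 * length cs))"

text \<open>For a single neighbour or an inner consecutive pair the interval is drawn tightly around
  the times \<open>3 * (k + 1)\<close> of the neighbours. The first two clique letters would need
  the interval from 2 to 7, straddling the time 4 at which the wrap-around slot starts; their slot
  is therefore moved to the second copy, around \<open>3 * length cs + 3\<close> and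
  \<open>3 * length cs + 6\<close>.\<close>

lemma slot_exists:
  assumes "distinct cs"
    and X: "X = {} \<or> (\<exists>u \<in> set cs. X = {u}) \<or>
      length cs \<ge> 3 \<and> (\<exists>u v. X = {u, v} \<and> (consecutive cs u v \<or> {u, v} = {hd cs, last cs}))"
  shows "\<exists>three a b. slot cs X three a b"
proof -
  have eq: "cs ! k = cs ! i \<longleftrightarrow> k = i" if "k < length cs" "i < length cs" for i k
    using assms(1) that by (simp add: nth_eq_iff_index_eq)
  consider (0) "X = {}" | (1) i where "i < length cs" "X = {cs ! i}"
    | (2) "length cs \<ge> 3" "X = {cs ! 0, cs ! 1}"
    | (3) i where "0 < i" "Suc i < length cs" "X = {cs ! i, cs ! Suc i}"
    | (4) "length cs \<ge> 3" "X = {cs ! 0, cs ! (length cs - 1)}"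
  proof -
    from X consider "X = {}" | u where "u \<in> set cs" "X = {u}"
      | i where "length cs \<ge> 3" "Suc i < length cs" "X = {cs ! i, cs ! Suc i}"
      | "length cs \<ge> 3" "X = {hd cs, last cs}"
      unfolding consecutive_def by metis
    then show thesis
    proof cases
      case 1
      then show thesis using 0 by blast
    next
      case 2
      then show thesis using \<open>\<And>i. i < length cs \<Longrightarrow> X = {cs ! i} \<Longrightarrow> thesis\<close> by (metis in_set_conv_nth)
    next
      case (3 i)
      then show thesis
        using \<open>length cs \<ge> 3 \<Longrightarrow> X = {cs ! 0, cs ! 1} \<Longrightarrow> thesis\<close>
          \<open>\<And>i. 0 < i \<Longrightarrow> Suc i < length cs \<Longrightarrow> X = {cs ! i, cs ! Suc i} \<Longrightarrow> thesis\<close>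
        by (cases i) auto
    next
      case 4
      then have "cs \<noteq> []" by auto
      then show thesis using 4 \<open>length cs \<ge> 3 \<Longrightarrow> X = {cs ! 0, cs ! (length cs - 1)} \<Longrightarrow> thesis\<close>
        by (simp add: hd_conv_nth last_conv_nth)
    qed
  qed
  then show ?thesis
  proof cases
    case 0
    then have "slot cs X True 0 1" by (auto simp: slot_def)
    then show ?thesis by blast
  next
    case (1 i)
    then have "slot cs X True (3 * i + 2) (3 * i + 4)" by (auto simp: slot_def eq)
    then show ?thesis by blast
  next
    case 2
    then have "slot cs X False (3 * length cs + 2) (3 * length cs + 7)" by (auto simp: slot_def)
    then show ?thesis by blast
  next
    case (3 i)
    then have "slot cs X True (3 * i + 2) (3 * i + 7)"
      using eq by (auto simp: slot_def)
    then show ?thesis by blast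
  next
    case 4
    then have "slot cs X False 4 (6 * length cs)" by (auto simp: slot_def)
    then show ?thesis by blast
  qed
qed

section \<open>Perturbed integer times\<close>

lemma nat_trichotomy: "(a :: nat) = b \<or> real a + 1 \<le> real b \<or> real b + 1 \<le> real a"
  by linarith

lemma frac_cancel:
  assumes "real a + r = real b + s \<or> real a - r = real b - s" "0 < r" "r < 1/2" "0 < s" "s < 1/2"
  shows "r = s"
  using nat_trichotomy[of a b] assms by auto

lemma frac_neq:
  assumes "0 < r" "r < 1/2" "0 < s" "s < 1/2"
  shows "real a + r \<noteq> real b - s" "real a + r \<noteq> real b" "real a - r \<noteq> real b"
  using nat_trichotomy[of a b] assms by auto

text \<open>Perturbations below one half cannot mix up different integer times, while being distinct
  they separate letters that share a slot. The summand 3 in the witness keeps its values below one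
  half.\<close>

lemma fractional_indices:
  assumes "finite I"
  shows "\<exists>r :: 'a \<Rightarrow> real. inj_on r I \<and> (\<forall>x \<in> I. 0 < r x \<and> r x < 1/2)"
proof -
  obtain g :: "'a \<Rightarrow> nat" where g: "inj_on g I"
    using finite_imp_inj_to_nat_seg[OF assms] by blast
  have "inj_on (\<lambda>x. 1 / (real (g x) + 3)) I"
    using g by (auto simp: inj_on_def)
  moreover have "0 < 1 / (real (g x) + 3) \<and> 1 / (real (g x) + 3) < 1/2" for x
    by (simp add: field_simps)
  ultimately show ?thesis by blast
qed

text \<open>The times of \<open>slot\<close>, perturbed by pairwise different amounts, yield the
  word. Alternation is read off from the order of the times, separately for clique pairs, mixed
  pairs and pairs in \<open>I\<close>.\<close>

lemma word_of_arrangement: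
  fixes N :: "'a \<Rightarrow> 'a set"
  assumes I: "finite I" and cs: "distinct cs" "set cs \<inter> I = {}"
    and N: "\<And>x. x \<in> I \<Longrightarrow> N x = {} \<or> (\<exists>u \<in> set cs. N x = {u}) \<or>
      length cs \<ge> 3 \<and> (\<exists>u v. N x = {u, v} \<and> (consecutive cs u v \<or> {u, v} = {hd cs, last cs}))"
  shows "\<exists>w. set w = I \<union> set cs \<and>
    (\<forall>u \<in> set cs. \<forall>v \<in> set cs. u \<noteq> v \<longrightarrow> alternate u v w) \<and>
    (\<forall>x \<in> I. \<forall>u \<in> set cs. alternate x u w \<longleftrightarrow> u \<in> N x) \<and>
    (\<forall>x \<in> I. \<forall>y \<in> I. x \<noteq> y \<longrightarrow> \<not> alternate x y w)"
proof -
  define m where "m = length cs"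
  have "\<forall>x \<in> I. \<exists>three a b. slot cs (N x) three a b"
    using slot_exists[OF cs(1) N] by blast
  then obtain three :: "'a \<Rightarrow> bool" and a b :: "'a \<Rightarrow> nat"
    where slot: "\<And>x. x \<in> I \<Longrightarrow> slot cs (N x) (three x) (a x) (b x)" by metis
  obtain r :: "'a \<Rightarrow> real" where r: "inj_on r I" "\<And>x. x \<in> I \<Longrightarrow> 0 < r x \<and> r x < 1/2"
    using fractional_indices[OF I] by blast
  \<comment> \<open>\<open>F x\<close> is just after \<open>a x\<close> and \<open>L x\<close> just
    before \<open>b x\<close>. Reflecting \<open>F x\<close> at the constant
    \<open>12 * m + 30\<close> reverses the order and lands after all other times; as
    \<open>a x \<le> 3 * m + 2\<close>, the subtraction of naturals is not truncated.\<close>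
  define F L S where "F x = real (a x) + r x" and "L x = real (b x) - r x"
    and "S x = real (12 * m + 30 - a x) - r x" for x
  define P where "P k = real (3 * (k + 1))" for k :: nat
  define pos where "pos = the_inv_into {..<m} ((!) cs)"
  have inj: "inj_on ((!) cs) {..<m}" using cs(1) by (simp add: inj_on_nth m_def)
  have pos: "pos (cs ! k) = k" if "k < m" for k
    unfolding pos_def using the_inv_into_f_f[OF inj, of k] that by simp
  define T where "T z = (if z \<in> I then (if three z then [F z, L z, S z] else [F z, L z])
    else [P (pos z), P (pos z + m)])" for z
  have T_clq: "T (cs ! k) = [P k, P (k + m)]" if "k < m" for k
  proof -
    have "cs ! k \<in> set cs" using that by (simp add: m_def)
    then have "cs ! k \<notin> I" using cs(2) by blast
    then show ?thesis using pos[OF that] by (simp add: T_def)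
  qed
  have slot3: "a x < b x \<and> b x \<le> 3 * m + 1 \<and> (b x \<le> 4 \<or> a x \<ge> 5) \<and>
      (\<forall>k < m. cs ! k \<in> N x \<longleftrightarrow> a x < 3 * (k + 1) \<and> 3 * (k + 1) < b x)" if "x \<in> I" "three x" for x
    using slot[OF that(1)] that(2) by (simp add: slot_def m_def)
  have slot2: "m \<ge> 3" "N x = {cs ! 0, cs ! 1} \<and> a x = 3 * m + 2 \<and> b x = 3 * m + 7 \<or>
      N x = {cs ! 0, cs ! (m - 1)} \<and> a x = 4 \<and> b x = 6 * m" if "x \<in> I" "\<not> three x" for x
    using slot[OF that(1)] that(2) by (simp_all add: slot_def m_def)
  have ab: "a x < b x" "a x \<le> 3 * m + 2" "b x \<le> 6 * m + 7" if "x \<in> I" for x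
    using slot3[OF that] slot2[OF that] by (cases "three x"; fastforce)+
  have rb: "0 < r x" "r x < 1/2" if "x \<in> I" for x using r(2) that by auto
  have S: "S x = 12 * real m + 30 - F x" if "x \<in> I" for x
    using ab(2)[OF that] by (simp add: S_def F_def of_nat_diff)
  have FL: "F x < L x" "F x < 3 * real m + 3" "L x < 6 * real m + 7" if "x \<in> I" for x
    using ab[OF that] rb[OF that] by (auto simp: F_def L_def)
  have FLS: "L x < S x" "L x < S y" "F x < S y" "P (k + m) < S x" if "x \<in> I" "y \<in> I" "k < m" for x y k
    using FL[OF that(1)] FL[OF that(2)] S that by (auto simp: P_def)
  have P_neq: "F x \<noteq> P k" "L x \<noteq> P k" "S x \<noteq> P k" if "x \<in> I" for x k
    using frac_neq(2,3)[OF rb[OF that] rb[OF that]] by (simp_all add: F_def L_def S_def P_def del: of_nat_mult of_nat_add)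
  have r_neq: "r x \<noteq> r y" if "x \<in> I" "y \<in> I" "x \<noteq> y" for x y
    using r(1) that by (auto dest: inj_onD)
  have FLS_neq: "F x \<noteq> F y" "L x \<noteq> L y" "F x \<noteq> L y" "F x \<noteq> S y" "L x \<noteq> S y" "S x \<noteq> S y"
    if xy: "x \<in> I" "y \<in> I" "x \<noteq> y" for x y
  proof -
    show F: "F x \<noteq> F y" and "L x \<noteq> L y"
      using frac_cancel[OF _ rb[OF xy(1)] rb[OF xy(2)]] r_neq[OF xy] by (auto simp: F_def L_def)
    show "F x \<noteq> L y" using frac_neq(1)[OF rb[OF xy(1)] rb[OF xy(2)]] by (simp add: F_def L_def)
    show "F x \<noteq> S y" "L x \<noteq> S y" "S x \<noteq> S y"
      using FL[OF xy(1)] FL[OF xy(2)] S[OF xy(1)] S[OF xy(2)] F by linarith+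
  qed
  have disj: "set (T x) \<inter> set (T y) = {}" if xy: "x \<in> I \<union> set cs" "y \<in> I \<union> set cs" "x \<noteq> y" for x y
  proof -
    have TI: "set (T x) \<subseteq> {F x, L x, S x}" if "x \<in> I" for x using that by (auto simp: T_def)
    have clq: "\<exists>k < m. z = cs ! k" if "z \<in> set cs" for z
      using that by (metis in_set_conv_nth m_def)
    consider "x \<in> I" "y \<in> I" | "x \<in> I" "y \<in> set cs" | "x \<in> set cs" "y \<in> I" | "x \<in> set cs" "y \<in> set cs"
      using xy by blast
    then show ?thesis
    proof cases
      case 1
      then have "{F x, L x, S x} \<inter> {F y, L y, S y} = {}"
        using FLS_neq[OF 1 xy(3)] FLS_neq[OF 1(2,1) xy(3)[symmetric]] by auto
      then show ?thesis using TI[OF 1(1)] TI[OF 1(2)] by blast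
    next
      case 2
      then obtain k where "k < m" "y = cs ! k" using clq by blast
      then have "{F x, L x, S x} \<inter> set (T y) = {}" using P_neq[OF 2(1)] T_clq by auto
      then show ?thesis using TI[OF 2(1)] by blast
    next
      case 3
      then obtain k where "k < m" "x = cs ! k" using clq by blast
      then have "{F y, L y, S y} \<inter> set (T x) = {}" using P_neq[OF 3(2)] T_clq by auto
      then show ?thesis using TI[OF 3(2)] by blast
    next
      case 4
      then obtain i j where "i < m" "x = cs ! i" "j < m" "y = cs ! j" using clq by blast
      then show ?thesis using xy(3) T_clq by (auto simp: P_def)
    qed
  qed
  have dist: "distinct (T x) \<and> T x \<noteq> []" if "x \<in> I \<union> set cs" for x
  proof (cases "x \<in> I")
    case True
    then show ?thesis
      using FL[OF True] S[OF True] by (auto simp: T_def)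
  next
    case False
    with that have "x \<in> set cs" by blast
    then obtain k where "k < m" "x = cs ! k" by (metis in_set_conv_nth m_def)
    then have "T x = [P k, P (k + m)]" "m > 0" using T_clq[of k] by simp_all
    then show ?thesis by (simp add: P_def)
  qed
  have "\<exists>w. set w = I \<union> set cs \<and> (\<forall>x \<in> I \<union> set cs. \<forall>y \<in> I \<union> set cs.
      x \<noteq> y \<longrightarrow> (alternate x y w \<longleftrightarrow> interleaved (T x) (T y)))"
    by (rule word_of_times) (use I in simp, (erule dist disj | erule (2) disj)+)
  then obtain w where set_w: "set w = I \<union> set cs"
    and alt: "\<forall>x \<in> I \<union> set cs. \<forall>y \<in> I \<union> set cs. x \<noteq> y \<longrightarrow> (alternate x y w \<longleftrightarrow> interleaved (T x) (T y))"
    by (elim exE conjE)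
  note w = set_w alt[rule_format]
  have clique: "interleaved (T (cs ! i)) (T (cs ! j))" if ij: "i < j" "j < m" for i j
    unfolding T_clq[OF less_trans[OF ij]] T_clq[OF ij(2)]
    by (rule interleaved_abab) (use ij in \<open>simp_all add: P_def\<close>)
  have adj: "interleaved (T x) (T (cs ! k)) \<longleftrightarrow> cs ! k \<in> N x" if x: "x \<in> I" and k: "k < m" for x k
  proof (cases "three x")
    case True
    note s = slot3[OF x True]
    have T: "T x = [F x, L x, S x]" "T (cs ! k) = [P k, P (k + m)]"
      using x True T_clq[OF k] by (simp_all add: T_def)
    \<comment> \<open>The first two occurrences of \<open>x\<close> precede the second copy of
      \<open>cs\<close>, which starts at \<open>3 * m + 3\<close>, so only the first occurrence of
      \<open>cs ! k\<close> can lie between them.\<close>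
    have LP: "L x < P (k + m)" using s rb[OF x] by (simp add: L_def P_def)
    show ?thesis
    proof (cases "cs ! k \<in> N x")
      case mem: True
      then have "a x < 3 * (k + 1)" "3 * (k + 1) < b x" using s k by auto
      then have "F x < P k" "P k < L x" using rb[OF x] by (simp_all add: F_def L_def P_def)
      then show ?thesis
        using mem interleaved_ababa[of "F x" "P k" "L x" "P (k + m)" "S x"] LP FLS(4)[OF x x k] T by simp
    next
      case False
      then consider "3 * (k + 1) \<le> a x" | "b x \<le> 3 * (k + 1)" using s k by (meson not_less)
      then show ?thesis
      proof cases
        case 1
        then have "P k < F x" using rb[OF x] by (simp add: F_def P_def)
        then have "\<not> interleaved (T (cs ! k)) (T x)"
          unfolding T using not_interleaved_abbab[of "P k" "F x" "L x" "P (k + m)" "S x"] LP FL(1)[OF x] FLS(1)[OF x x k]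
          by simp
        then show ?thesis using False interleaved_commute by blast
      next
        case 2
        then have "L x < P k" using rb[OF x] by (simp add: L_def P_def)
        moreover have "P k < P (k + m)" using k by (simp add: P_def)
        ultimately show ?thesis
          using False not_interleaved_aabb[of "F x" "L x" "P k" "P (k + m)" "[S x]"] FL(1)[OF x] T by simp
      qed
    qed
  next
    case False
    note s = slot2[OF x False]
    have T: "T x = [F x, L x]" "T (cs ! k) = [P k, P (k + m)]"
      using x False T_clq[OF k] by (simp_all add: T_def)
    have eq: "cs ! k = cs ! i \<longleftrightarrow> k = i" if "i < m" for i
      using that k cs(1) by (simp add: nth_eq_iff_index_eq m_def)
    from s(2) show ?thesis
    proof
      assume B: "N x = {cs ! 0, cs ! 1} \<and> a x = 3 * m + 2 \<and> b x = 3 * m + 7"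
      have "cs ! k = cs ! 0 \<longleftrightarrow> k = 0" "cs ! k = cs ! 1 \<longleftrightarrow> k = 1"
        using s(1) eq[of 0] eq[of 1] by linarith+
      with B have "cs ! k \<in> N x \<longleftrightarrow> k = 0 \<or> k = 1" by simp
      then have mem: "cs ! k \<in> N x \<longleftrightarrow> k < 2" by linarith
      \<comment> \<open>Both occurrences of \<open>x\<close> follow the first copy of
        \<open>cs\<close>, so alternation depends on whether the second \<open>cs ! k\<close> lies
        between them.\<close>
      have PF: "P k < F x" using B k rb[OF x] by (simp add: P_def F_def)
      show ?thesis
      proof (cases "k < 2")
        case True
        then have "F x < P (k + m)" "P (k + m) < L x"
          using B rb[OF x] by (simp_all add: P_def F_def L_def)
        then have "interleaved (T (cs ! k)) (T x)" unfolding T using PF by (intro interleaved_abab)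
        then show ?thesis using mem True interleaved_commute by blast
      next
        case False
        then have "L x < P (k + m)" using B rb[OF x] by (simp add: P_def L_def)
        then have "\<not> interleaved (T (cs ! k)) (T x)"
          unfolding T using PF FL(1)[OF x] by (intro not_interleaved_abba)
        then show ?thesis using mem False interleaved_commute by blast
      qed
    next
      assume C: "N x = {cs ! 0, cs ! (m - 1)} \<and> a x = 4 \<and> b x = 6 * m"
      have "cs ! k = cs ! 0 \<longleftrightarrow> k = 0" "cs ! k = cs ! (m - 1) \<longleftrightarrow> k = m - 1"
        using s(1) eq[of 0] eq[of "m - 1"] by linarith+
      with C have mem: "cs ! k \<in> N x \<longleftrightarrow> k = 0 \<or> k = m - 1" by simp
      \<comment> \<open>With \<open>c\<close> for \<open>cs ! k\<close>, the patterns are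
        \<open>c x c x\<close> for the first letter, \<open>x c x c\<close> for the last and
        \<open>x c c x\<close> for those in between.\<close>
      consider "k = 0" | "k = m - 1" "k \<noteq> 0" | "0 < k" "k < m - 1" using k by linarith
      then show ?thesis
      proof cases
        case 1
        then have "P k < F x" "F x < P (k + m)" "P (k + m) < L x"
          using C s(1) rb[OF x] by (simp_all add: P_def F_def L_def)
        then have "interleaved (T (cs ! k)) (T x)" unfolding T by (intro interleaved_abab)
        then show ?thesis using mem 1 interleaved_commute by blast
      next
        case 2
        then have "F x < P k" "P k < L x" "L x < P (k + m)"
          using C s(1) rb[OF x] by (simp_all add: P_def F_def L_def)
        then have "interleaved (T x) (T (cs ! k))" unfolding T by (intro interleaved_abab)
        then show ?thesis using mem 2 by blast
      next
        case 3
        then have "F x < P k" "P k < P (k + m)" "P (k + m) < L x"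
          using C s(1) rb[OF x] by (simp_all add: P_def F_def L_def)
        then have "\<not> interleaved (T x) (T (cs ! k))" unfolding T by (intro not_interleaved_abba)
        then show ?thesis using mem 3 by auto
      qed
    qed
  qed
  \<comment> \<open>With three occurrences each, alternation needs different first and last letters,
    but the reversed third occurrences make \<open>x\<close> both first and last.\<close>
  have indep3: "\<not> interleaved (T x) (T y)" if x: "x \<in> I" "three x" and y: "y \<in> I" "three y" and F: "F x < F y" for x y
  proof -
    have "T x = [F x, L x, S x]" "T y = [F y, L y, S y]" using x y by (simp_all add: T_def)
    moreover have "F y < L y" "L x < S y" "L y < S y" "S y < S x"
      using FL[OF x(1)] FL[OF y(1)] S[OF x(1)] S[OF y(1)] F by linarith+
    ultimately show ?thesis using F not_interleaved_even by simp
  qed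
  \<comment> \<open>The interval of \<open>x\<close> does not straddle the time 4, so
    \<open>x\<close> occurs twice before \<open>y\<close> starts or twice between the two
    occurrences of \<open>y\<close>. A straddling interval would make them alternate.\<close>
  have indep32: "\<not> interleaved (T x) (T y)" if x: "x \<in> I" "three x" and y: "y \<in> I" "\<not> three y" for x y
  proof -
    have T: "T x = [F x, L x, S x]" "T y = [F y, L y]" using x y by (simp_all add: T_def)
    note sx = slot3[OF x] and sy = slot2[OF y]
    consider "L x < F y" | "F y < F x" "L x < L y"
    proof (cases "a y = 4")
      case True
      then have "b y = 6 * m" using sy by auto
      then have "L x < L y" using sx sy(1) rb[OF x(1)] rb[OF y(1)] by (simp add: L_def)
      moreover have "L x < F y \<or> F y < F x"
        using sx True rb[OF x(1)] rb[OF y(1)] by (auto simp: L_def F_def)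
      ultimately show thesis using that by blast
    next
      case False
      then have "a y = 3 * m + 2" using sy by auto
      then have "L x < F y" using sx rb[OF x(1)] rb[OF y(1)] by (simp add: L_def F_def)
      then show thesis using that by blast
    qed
    then show ?thesis
    proof cases
      case 1
      then show ?thesis unfolding T using FL(1)[OF x(1)] FL(1)[OF y(1)] by (intro not_interleaved_aabb)
    next
      case 2
      have "L x < S x" using FL[OF x(1)] S[OF x(1)] by linarith
      then have "\<not> interleaved (T y) (T x)"
        unfolding T using 2 FL(1)[OF x(1)] by (intro not_interleaved_abbab)
      then show ?thesis using interleaved_commute by blast
    qed
  qed
  have nested: "\<not> interleaved (T x) (T y)"
    if "x \<in> I" "\<not> three x" "y \<in> I" "\<not> three y" "F x < F y" "L y < L x" for x y
    using that FL(1) not_interleaved_abba[of "F x" "F y" "L y" "L x"] by (simp add: T_def)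
  \<comment> \<open>In a common slot the perturbation moves \<open>F\<close> and \<open>L\<close> in
    opposite directions, which nests the intervals. Of the two slots, the wrap-around one contains
    the other because \<open>m \<ge> 3\<close> gives \<open>3 * m + 7 < 6 * m\<close>.\<close>
  have indep2: "\<not> interleaved (T x) (T y)" if x: "x \<in> I" "\<not> three x" and y: "y \<in> I" "\<not> three y"
    and xy: "a x < a y \<or> a x = a y \<and> r x < r y" for x y
  proof (rule nested[OF x y])
    have s: "a z = 3 * m + 2 \<and> b z = 3 * m + 7 \<or> a z = 4 \<and> b z = 6 * m" if "z \<in> I" "\<not> three z" for z
      using slot2(2)[OF that] by blast
    have "a x = a y \<and> b x = b y \<and> r x < r y \<or> a x = 4 \<and> b x = 6 * m \<and> a y = 3 * m + 2 \<and> b y = 3 * m + 7"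
      using xy s[OF x] s[OF y] slot2(1)[OF x] by auto
    then have "F x < F y \<and> L y < L x"
      using slot2(1)[OF x] rb[OF x(1)] rb[OF y(1)] by (auto simp: F_def L_def)
    then show "F x < F y" "L y < L x" by auto
  qed
  have indep: "\<not> interleaved (T x) (T y)" if "x \<in> I" "y \<in> I" "x \<noteq> y" for x y
  proof (cases "three x"; cases "three y")
    assume "three x" "three y"
    then show ?thesis
      using indep3[of x y] indep3[of y x] that FLS_neq(1)[OF that] interleaved_commute
      by (metis linorder_neqE)
  next
    assume "three x" "\<not> three y"
    then show ?thesis using indep32 that by blast
  next
    assume "\<not> three x" "three y"
    then show ?thesis using indep32[of y x] that interleaved_commute by blast
  next
    assume "\<not> three x" "\<not> three y"
    moreover have "(a x < a y \<or> a x = a y \<and> r x < r y) \<or> (a y < a x \<or> a y = a x \<and> r y < r x)"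
      using r_neq[OF that] by linarith
    ultimately show ?thesis
      using indep2[of x y] indep2[of y x] that interleaved_commute by blast
  qed
  show ?thesis
  proof (intro exI[of _ w] conjI ballI impI)
    fix u v assume uv: "u \<in> set cs" "v \<in> set cs" "u \<noteq> v"
    then obtain i j where ij: "i < m" "u = cs ! i" "j < m" "v = cs ! j" by (metis in_set_conv_nth m_def)
    then have "i \<noteq> j" using uv(3) by auto
    then have "interleaved (T u) (T v)"
      using clique[of i j] clique[of j i] ij interleaved_commute by (cases "i < j") auto
    then show "alternate u v w" using w(2) uv by blast
  next
    fix x u assume xu: "x \<in> I" "u \<in> set cs"
    then obtain k where k: "k < m" "u = cs ! k" by (metis in_set_conv_nth m_def)
    have "x \<noteq> u" using xu cs(2) by auto
    then have "alternate x u w \<longleftrightarrow> interleaved (T x) (T u)" using w(2) xu by blast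
    then show "alternate x u w \<longleftrightarrow> u \<in> N x" using adj[OF xu(1) k(1)] k(2) by simp
  next
    fix x y assume "x \<in> I" "y \<in> I" "x \<noteq> y"
    then show "\<not> alternate x y w" using w(2) indep by blast
  qed (rule w(1))
qed

subsection \<open>Split graphs with independent vertices of degree at most two\<close>

definition nbhd :: "'a pair_pre_digraph \<Rightarrow> 'a \<Rightarrow> 'a set" where
  "nbhd G x = {u. (x, u) \<in> parcs G}"

lemma card_nbhd: "card (nbhd G x) = out_degree (with_proj G) x"
proof -
  have "out_arcs (with_proj G) x = Pair x ` nbhd G x"
    by (auto simp: nbhd_def out_arcs_def)
  then show ?thesis by (simp add: out_degree_def card_image inj_on_def)
qed

text \<open>Adjacency within the two parts is forced in both graphs, and \<open>I\<close> and
  \<open>K\<close> are disjoint. So an embedding only has to be injective on each part and to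
  respect adjacency between the parts.\<close>

lemma contains_induced_split:
  assumes G: "split_graph G n m I K" and H: "pair_graph H" "pverts H = C \<union> J"
    and H_clique: "\<And>u v. u \<in> C \<Longrightarrow> v \<in> C \<Longrightarrow> u \<noteq> v \<Longrightarrow> (u, v) \<in> parcs H"
    and H_indep: "\<And>u v. u \<in> J \<Longrightarrow> v \<in> J \<Longrightarrow> (u, v) \<notin> parcs H"
    and f: "inj_on f C" "inj_on f J" "f ` C \<subseteq> K" "f ` J \<subseteq> I"
    and adj: "\<And>j c. j \<in> J \<Longrightarrow> c \<in> C \<Longrightarrow> (j, c) \<in> parcs H \<longleftrightarrow> f c \<in> nbhd G (f j)"
  shows "contains_induced G H"
proof -
  have G': "pair_graph G" "pverts G = I \<union> K" "I \<inter> K = {}"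
    and G_clique: "\<And>u v. u \<in> K \<Longrightarrow> v \<in> K \<Longrightarrow> u \<noteq> v \<Longrightarrow> (u, v) \<in> parcs G"
    and G_indep: "\<And>u v. u \<in> I \<Longrightarrow> v \<in> I \<Longrightarrow> (u, v) \<notin> parcs G"
    using G by (auto simp: split_graph_def)
  interpret G: pair_graph G by fact
  interpret H: pair_graph H by fact
  have G_sym: "(u, v) \<in> parcs G \<longleftrightarrow> (v, u) \<in> parcs G" for u v
    using G.sym_arcs by (auto simp: symmetric_def dest: symD)
  have H_sym: "(u, v) \<in> parcs H \<longleftrightarrow> (v, u) \<in> parcs H" for u v
    using H.sym_arcs by (auto simp: symmetric_def dest: symD)
  have fC: "f u \<in> K" if "u \<in> C" for u using that f(3) by blast
  have fJ: "f u \<in> I" if "u \<in> J" for u using that f(4) by blast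
  have inj: "inj_on f (pverts H)"
  proof (rule inj_onI)
    fix u v assume uv: "u \<in> pverts H" "v \<in> pverts H" "f u = f v"
    have "u \<in> C \<and> v \<in> C \<or> u \<in> J \<and> v \<in> J"
      using uv H(2) fC[of u] fC[of v] fJ[of u] fJ[of v] G'(3) by fastforce
    then show "u = v" using f(1,2) uv(3) by (auto dest: inj_onD)
  qed
  have irreflG: "(u, u) \<notin> parcs G" for u using G.no_loops by fastforce
  have irreflH: "(u, u) \<notin> parcs H" for u using H.no_loops by fastforce
  have arcs: "(f u, f v) \<in> parcs G \<longleftrightarrow> (u, v) \<in> parcs H" if uv: "u \<in> pverts H" "v \<in> pverts H" for u v
  proof -
    consider "u \<in> C" "v \<in> C" | "u \<in> J" "v \<in> J" | "u \<in> J" "v \<in> C" | "u \<in> C" "v \<in> J"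
      using uv H(2) by blast
    then show ?thesis
    proof cases
      case 1
      then show ?thesis
        using H_clique[OF 1] G_clique[OF fC fC] irreflG irreflH f(1) by (metis inj_onD)
    next
      case 2
      then show ?thesis using H_indep[OF 2] G_indep[OF fJ fJ] by simp
    next
      case 3
      then show ?thesis using adj[OF 3] by (simp add: nbhd_def)
    next
      case 4
      then show ?thesis
        using adj[OF 4(2,1)] G_sym[of "f u" "f v"] H_sym[of u v] by (simp add: nbhd_def)
    qed
  qed
  have "f ` pverts H \<subseteq> pverts G" using f(3,4) G'(2) H(2) by auto
  then show ?thesis using contains_induced_iff[OF H(1) G'(1)] inj arcs by blast
qed

text \<open>The common neighbour \<open>u\<close> plays the clique vertex 2 of \<open>T2\<close>,
  and the three tips are distinct because their neighbourhoods are.\<close>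

lemma contains_T2:
  assumes G: "split_graph G n m I K" and K: "u \<in> K" "a \<in> K" "b \<in> K" "c \<in> K" "distinct [u, a, b, c]"
    and I: "x \<in> I" "y \<in> I" "z \<in> I" "nbhd G x = {u, a}" "nbhd G y = {u, b}" "nbhd G z = {u, c}"
  shows "contains_induced G T2"
proof -
  define f where "f v = (case v of
      Clq i \<Rightarrow> if i = 1 then a else if i = 2 then u else if i = 3 then b else c
    | Tip i \<Rightarrow> if i = 1 then x else if i = 2 then y else z
    | Apex \<Rightarrow> u)" for v
  have xyz: "x \<noteq> y" "x \<noteq> z" "y \<noteq> z"
    using I(4-6) K(5) by (auto simp: doubleton_eq_iff)
  show ?thesis
  proof (rule contains_induced_split[OF G pair_graph_T2 T2_verts])
    show "(v, v') \<in> parcs T2" if "v \<in> Clq ` {1, 2, 3, 4}" "v' \<in> Clq ` {1, 2, 3, 4}" "v \<noteq> v'" for v v'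
      using that T2_clique by blast
    show "(v, v') \<notin> parcs T2" if "v \<in> Tip ` {1, 2, 3}" "v' \<in> Tip ` {1, 2, 3}" for v v'
      using that T2_tips by blast
    show "inj_on f (Clq ` {1, 2, 3, 4})" using K(5) by (auto simp: f_def inj_on_def)
    show "inj_on f (Tip ` {1, 2, 3})" using xyz by (auto simp: f_def inj_on_def)
    show "f ` Clq ` {1, 2, 3, 4} \<subseteq> K" using K by (simp add: f_def)
    show "f ` Tip ` {1, 2, 3} \<subseteq> I" using I by (simp add: f_def)
    show "(t, v) \<in> parcs T2 \<longleftrightarrow> f v \<in> nbhd G (f t)"
      if tv: "t \<in> Tip ` {1, 2, 3}" "v \<in> Clq ` {1, 2, 3, 4}" for t v
    proof -
      obtain i j where "t = Tip i" "v = Clq j" "i \<in> {1, 2, 3}" "j \<in> {1, 2, 3, 4}"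
        using tv by (elim imageE)
      then show ?thesis using K(5) I(4-6) by (simp add: f_def T2_tip) auto
    qed
  qed
qed

text \<open>The cycle supplies the numbered clique vertices, the independent vertices sitting on its
  edges supply the tips, and \<open>z\<close> off the cycle is the apex.\<close>

lemma contains_A_graph:
  assumes G: "split_graph G n m I K" and p: "distinct p" "set p \<subseteq> K" "length p \<ge> 3"
    and z: "z \<in> K - set p"
    and tips: "\<And>i. Suc i < length p \<Longrightarrow> \<exists>x \<in> I. nbhd G x = {p ! i, p ! Suc i}"
      "\<exists>x \<in> I. nbhd G x = {last p, hd p}"
  shows "contains_induced G (A_graph (Suc (length p)))"
proof -
  define r where "r = length p"
  define succ where "succ i = (if i = r then 1 else Suc i)" for i
  \<comment> \<open>The vertices of \<open>A_graph\<close> are numbered from 1, the entries of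
    \<open>p\<close> from 0.\<close>
  have p_eq: "p ! (i - 1) = p ! (j - 1) \<longleftrightarrow> i = j" if "i \<in> {1..r}" "j \<in> {1..r}" for i j
    using that p(1) by (auto simp: nth_eq_iff_index_eq r_def)
  have succ: "succ i \<in> {1..r}" if "i \<in> {1..r}" for i
    using that by (auto simp: succ_def)
  have "\<exists>x \<in> I. nbhd G x = {p ! (i - 1), p ! (succ i - 1)}" if i: "i \<in> {1..r}" for i
  proof (cases "i = r")
    case True
    have "p \<noteq> []" using p(3) by auto
    then show ?thesis using tips(2) True by (simp add: succ_def r_def last_conv_nth hd_conv_nth)
  next
    case False
    then show ?thesis using tips(1)[of "i - 1"] i by (simp add: succ_def r_def)
  qed
  then obtain x where x: "\<And>i. i \<in> {1..r} \<Longrightarrow> x i \<in> I"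
      "\<And>i. i \<in> {1..r} \<Longrightarrow> nbhd G (x i) = {p ! (i - 1), p ! (succ i - 1)}"
    by metis
  define f where "f v = (case v of Clq i \<Rightarrow> p ! (i - 1) | Tip i \<Rightarrow> x i | Apex \<Rightarrow> z)" for v
  have f: "f (Clq i) = p ! (i - 1)" "f (Tip i) = x i" "f Apex = z" for i
    by (simp_all add: f_def)
  have pK: "p ! (i - 1) \<in> set p" if "i \<in> {1..r}" for i
    using that by (auto simp: r_def)
  have x_inj: "i = j" if ij: "i \<in> {1..r}" "j \<in> {1..r}" "x i = x j" for i j
  proof (rule ccontr)
    assume "i \<noteq> j"
    have "{p ! (i - 1), p ! (succ i - 1)} = {p ! (j - 1), p ! (succ j - 1)}"
      using x(2)[OF ij(1)] x(2)[OF ij(2)] ij(3) by simp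
    \<comment> \<open>Different indices with the same neighbourhood would be successors of each
      other, which only happens in a cycle of length two.\<close>
    then have "i = succ j" "succ i = j"
      using \<open>i \<noteq> j\<close> p_eq ij(1,2) succ by (metis doubleton_eq_iff)+
    then show False using p(3) ij(1,2) \<open>i \<noteq> j\<close> by (auto simp: succ_def r_def split: if_splits)
  qed
  have "contains_induced G (A_graph (Suc r))"
  proof (rule contains_induced_split[OF G pair_graph_A_graph A_graph_verts])
    show "4 \<le> Suc r" using p(3) by (simp add: r_def)
    show "(v, v') \<in> parcs (A_graph (Suc r))"
      if "v \<in> insert Apex (Clq ` {1..r})" "v' \<in> insert Apex (Clq ` {1..r})" "v \<noteq> v'" for v v'
      using that by (rule A_graph_clique)
    show "(v, v') \<notin> parcs (A_graph (Suc r))" if "v \<in> Tip ` {1..r}" "v' \<in> Tip ` {1..r}" for v v'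
      using that A_graph_tips by blast
    have "inj_on f (Clq ` {1..r})"
      using p_eq by (auto simp: inj_on_def f)
    moreover have "f Apex \<notin> f ` (Clq ` {1..r} - {Apex})" using z pK by (auto simp: f)
    ultimately show "inj_on f (insert Apex (Clq ` {1..r}))" by (rule inj_on_insert[THEN iffD2, OF conjI])
    show "inj_on f (Tip ` {1..r})" using x_inj by (auto simp: inj_on_def f)
    show "f ` insert Apex (Clq ` {1..r}) \<subseteq> K"
    proof (intro image_subsetI, elim insertE imageE)
      fix v i assume "v = Clq i" "i \<in> {1..r}"
      then show "f v \<in> K" using pK[of i] p(2) by (simp add: f subset_iff)
    qed (use z f in simp)
    show "f ` Tip ` {1..r} \<subseteq> I" using x(1) by (auto simp: f)
    show "(t, v) \<in> parcs (A_graph (Suc r)) \<longleftrightarrow> f v \<in> nbhd G (f t)"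
      if tv: "t \<in> Tip ` {1..r}" "v \<in> insert Apex (Clq ` {1..r})" for t v
    proof -
      obtain i where t: "t = Tip i" and i: "i \<in> {1..r}" using tv(1) by (elim imageE)
      show ?thesis
      proof (cases "v = Apex")
        case True
        have "z \<noteq> p ! (i - 1)" "z \<noteq> p ! (succ i - 1)" using z pK[OF i] pK[OF succ[OF i]] by auto
        then show ?thesis using True t x(2)[OF i] A_graph_tip(2)[OF i i] by (simp add: f)
      next
        case False
        then obtain j where v: "v = Clq j" and j: "j \<in> {1..r}" using tv(2) by blast
        have "f v \<in> nbhd G (f t) \<longleftrightarrow> j = i \<or> j = succ i"
          using p_eq[OF j i] p_eq[OF j succ[OF i]] x(2)[OF i] by (simp add: f t v)
        then show ?thesis using A_graph_tip(1)[OF i j] by (simp add: t v succ_def)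
      qed
    qed
  qed
  then show ?thesis by (simp add: r_def)
qed

text \<open>Excluding \<open>T2\<close> bounds the degrees in the graph of joined pairs by two, and
  excluding the graphs \<open>A_graph l\<close> makes its cycles spanning. Then
  \<open>cyclic_arrangement\<close> orders the clique and \<open>word_of_arrangement\<close> gives
  the word.\<close>

lemma word_representable_split:
  assumes G: "split_graph G n m I K"
    and degree: "\<forall>v \<in> I. out_degree (with_proj G) v \<le> 2"
    and T2: "\<not> contains_induced G T2" and A: "\<forall>l \<ge> 4. \<not> contains_induced G (A_graph l)"
  shows "word_representable G"
proof -
  have G': "pair_graph G" "pverts G = I \<union> K" "I \<inter> K = {}" "card K = m"
    and G_clique: "\<And>u v. u \<in> K \<Longrightarrow> v \<in> K \<Longrightarrow> u \<noteq> v \<Longrightarrow> (u, v) \<in> parcs G"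
    and G_indep: "\<And>u v. u \<in> I \<Longrightarrow> v \<in> I \<Longrightarrow> (u, v) \<notin> parcs G"
    and max: "\<And>v. v \<in> I \<Longrightarrow> out_degree (with_proj G) v \<le> m - 1"
    using G by (auto simp: split_graph_def)
  interpret G: pair_graph G by fact
  have fin: "finite I" "finite K" using G.finite_verts G'(2) by auto
  have G_sym: "(u, v) \<in> parcs G \<longleftrightarrow> (v, u) \<in> parcs G" for u v
    using G.sym_arcs by (auto simp: symmetric_def dest: symD)
  have nbhd_K: "nbhd G x \<subseteq> K" if "x \<in> I" for x
  proof
    fix u assume "u \<in> nbhd G x"
    then have "(x, u) \<in> parcs G" by (simp add: nbhd_def)
    then have "u \<in> I \<union> K" "u \<notin> I" using G.in_arcsD2 G'(2) G_indep[OF that] by auto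
    then show "u \<in> K" by simp
  qed
  \<comment> \<open>The condition \<open>u \<noteq> v\<close> keeps independent vertices of degree
    one from producing loops.\<close>
  define E where "E u v \<longleftrightarrow> u \<noteq> v \<and> (\<exists>x \<in> I. nbhd G x = {u, v})" for u v
  have E_K: "u \<in> K \<and> v \<in> K" if "E u v" for u v
    using that nbhd_K unfolding E_def by blast
  interpret E: graph_max_degree_2 E
  proof
    show "E v u" if "E u v" for u v using that by (auto simp: E_def insert_commute)
    show "\<not> E u u" for u by (simp add: E_def)
    show "a = b \<or> a = c \<or> b = c" if E: "E u a" "E u b" "E u c" for u a b c
    proof (rule ccontr)
      assume neq: "\<not> ?thesis"
      obtain x y z where "x \<in> I" "y \<in> I" "z \<in> I" "nbhd G x = {u, a}" "nbhd G y = {u, b}" "nbhd G z = {u, c}"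
        using E unfolding E_def by blast
      moreover have "distinct [u, a, b, c]" using E neq by (auto simp: E_def)
      ultimately show False using contains_T2[OF G] T2 E E_K by meson
    qed
  qed
  have spanning: "set p = K"
    if p: "distinct p" "successively E p" "set p \<subseteq> K" "length p \<ge> 3" "E (last p) (hd p)" for p
  proof (rule ccontr)
    assume "set p \<noteq> K"
    then obtain z where z: "z \<in> K - set p" using p(3) by blast
    have "contains_induced G (A_graph (Suc (length p)))"
    proof (rule contains_A_graph[OF G p(1,3,4) z])
      show "\<exists>x \<in> I. nbhd G x = {p ! i, p ! Suc i}" if "Suc i < length p" for i
        using successively_nth[OF p(2) that] by (simp add: E_def)
      show "\<exists>x \<in> I. nbhd G x = {last p, hd p}" using p(5) by (simp add: E_def)
    qed
    then show False using A p(4) by simp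
  qed
  have "\<exists>cs. distinct cs \<and> set cs = K \<and>
      (\<forall>u \<in> K. \<forall>v \<in> K. E u v \<longrightarrow> consecutive cs u v \<or> {u, v} = {hd cs, last cs})"
    by (rule E.cyclic_arrangement[OF fin(2)]) (rule spanning)
  then obtain cs where cs: "distinct cs" "set cs = K"
    and "\<forall>u \<in> K. \<forall>v \<in> K. E u v \<longrightarrow> consecutive cs u v \<or> {u, v} = {hd cs, last cs}"
    by (elim exE conjE)
  then have E_cs: "consecutive cs u v \<or> {u, v} = {hd cs, last cs}" if "E u v" for u v
    using that E_K[OF that] by simp
  have len: "length cs = m" using cs G'(4) distinct_card by fastforce
  have types: "nbhd G x = {} \<or> (\<exists>u \<in> set cs. nbhd G x = {u}) \<or>
      length cs \<ge> 3 \<and> (\<exists>u v. nbhd G x = {u, v} \<and> (consecutive cs u v \<or> {u, v} = {hd cs, last cs}))"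
    if x: "x \<in> I" for x
  proof -
    have fin_x: "finite (nbhd G x)" using nbhd_K[OF x] fin(2) finite_subset by blast
    have "card (nbhd G x) \<le> 2" using degree x by (simp add: card_nbhd)
    then consider "card (nbhd G x) = 0" | "card (nbhd G x) = 1" | "card (nbhd G x) = 2" by linarith
    then show ?thesis
    proof cases
      case 1
      then show ?thesis using fin_x by simp
    next
      case 2
      then obtain u where "nbhd G x = {u}" by (auto simp: card_1_singleton_iff)
      then show ?thesis using nbhd_K[OF x] cs(2) by auto
    next
      case 3
      then obtain u v where uv: "nbhd G x = {u, v}" "u \<noteq> v" by (auto simp: card_2_iff)
      then have "E u v" using x by (auto simp: E_def)
      \<comment> \<open>This is the maximality of the clique: the degree 2 is at most
        \<open>m - 1\<close>.\<close>
      moreover have "length cs \<ge> 3" using 3 max[OF x] len by (simp add: card_nbhd)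
      ultimately show ?thesis using E_cs uv(1) by blast
    qed
  qed
  have "set cs \<inter> I = {}" using cs(2) G'(3) by blast
  then have "\<exists>w. set w = I \<union> set cs \<and>
      (\<forall>u \<in> set cs. \<forall>v \<in> set cs. u \<noteq> v \<longrightarrow> alternate u v w) \<and>
      (\<forall>x \<in> I. \<forall>u \<in> set cs. alternate x u w \<longleftrightarrow> u \<in> nbhd G x) \<and>
      (\<forall>x \<in> I. \<forall>y \<in> I. x \<noteq> y \<longrightarrow> \<not> alternate x y w)"
    by (rule word_of_arrangement[OF fin(1) cs(1)]) (rule types)
  then obtain w where w: "set w = I \<union> set cs"
    and clique: "\<forall>u \<in> set cs. \<forall>v \<in> set cs. u \<noteq> v \<longrightarrow> alternate u v w"
    and adj: "\<forall>x \<in> I. \<forall>u \<in> set cs. alternate x u w \<longleftrightarrow> u \<in> nbhd G x"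
    and indep: "\<forall>x \<in> I. \<forall>y \<in> I. x \<noteq> y \<longrightarrow> \<not> alternate x y w"
    by (elim exE conjE)
  show ?thesis
    unfolding word_representable_def
  proof (intro exI[of _ w] conjI ballI impI)
    show "set w = pverts G" using w cs(2) G'(2) by simp
    fix x y assume "x \<in> pverts G" "y \<in> pverts G" and neq: "x \<noteq> y"
    then consider "x \<in> I" "y \<in> I" | "x \<in> I" "y \<in> K" | "x \<in> K" "y \<in> I" | "x \<in> K" "y \<in> K"
      using G'(2) by blast
    then show "alternate x y w \<longleftrightarrow> (x, y) \<in> parcs G"
    proof cases
      case 1
      then show ?thesis using indep G_indep neq by simp
    next
      case 2
      then show ?thesis using adj cs(2) by (simp add: nbhd_def)
    next
      case 3
      then show ?thesis
        using adj cs(2) alternate_commute[of x y w] G_sym[of x y] by (simp add: nbhd_def)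
    next
      case 4
      then show ?thesis using clique G_clique cs(2) neq by simp
    qed
  qed
qed

theorem theorem12:
  fixes G :: "'a pair_pre_digraph" and n m :: nat and I K :: "'a set"
  assumes "m \<ge> 1"
    and "split_graph G n m I K"
    and "\<forall>v \<in> I. out_degree (with_proj G) v \<le> 2"
  shows "word_representable G \<longleftrightarrow>
    \<not> contains_induced G T2 \<and> (\<forall>l \<ge> 4. \<not> contains_induced G (A_graph l))"
proof -
  have "pair_graph G" using assms(2) by (simp add: split_graph_def)
  then show ?thesis
    using word_representable_split[OF assms(2,3)] T2_not_word_representable A_graph_not_word_representable
    by blast
qed

end
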